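(* For the regular icosahedron ($n=12$) and the regular dodecahedron ($n=20$) with circumradius $R>0$, and for any point $M$ of the space, $$S_{[n]}^{(8)}-\left(S_{[n]}^{(2)}\right)^4=8R^2\left(S_{[n]}^{(2)}-R^2\right)\left(\left(S_{[n]}^{(2)}\right)^2+\frac25R^2\left(S_{[n]}^{(2)}-R^2\right)\right),$$ $$S_{[n]}^{(10)}-\left(S_{[n]}^{(2)}\right)^5=8R^2S_{[n]}^{(2)}\left(S_{[n]}^{(2)}-R^2\right)\left(\frac53\left(S_{[n]}^{(2)}\right)^2+2R^2\left(S_{[n]}^{(2)}-R^2\right)\right),$$ $$S_{[n]}^{(8)}=\frac15\left(9\left(S_{[n]}^{(4)}\right)^2+12S_{[n]}^{(4)}\left(S_{[n]}^{(2)}\right)^2-16\left(S_{[n]}^{(2)}\right)^4\right),$$ $$S_{[n]}^{(10)}=S_{[n]}^{(2)}S_{[n]}^{(4)}\left(9S_{[n]}^{(4)}-8\left(S_{[n]}^{(2)}\right)^2\right).$$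
   Context: For the solid with $n$ vertices $A_1,\dots,A_n$ in Euclidean $3$-space and a point $M$ of the space, put $d_i=|MA_i|$ and $S_{[n]}^{(2m)}=\frac1n\sum_{i=1}^n d_i^{2m}$. *)

theory Defs
  imports "HOL-Analysis.Analysis"
begin

definition vertices :: "(real^3) set \<Rightarrow> (real^3) set" where
  "vertices P = {v. v extreme_point_of P}"

text \<open>The convex regular \<open>p\<close>-gons in space: \<open>p\<close> points equally spaced on a circle of radius \<open>r\<close>
  and centre \<open>c\<close>, in the plane through \<open>c\<close> with orthonormal directions \<open>u\<close>, \<open>w\<close>.\<close>

definition regular_polygon :: "nat \<Rightarrow> real \<Rightarrow> (real^3) set \<Rightarrow> bool" where
  "regular_polygon p r F \<longleftrightarrow> 3 \<le> p \<and> 0 < r \<and>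
     (\<exists>c u w. norm u = 1 \<and> norm w = 1 \<and> u \<bullet> w = 0 \<and>
        F = convex hull ((\<lambda>k. c + r *\<^sub>R (cos (2 * pi * real k / real p) *\<^sub>R u
                                  + sin (2 * pi * real k / real p) *\<^sub>R w)) ` {..<p}))"

text \<open>The regular convex polyhedra of Schlaefli type \<open>{p, q}\<close>: the faces are congruent regular
  \<open>p\<close>-gons (congruent because they share the circumradius \<open>r\<close>) and every vertex lies on exactly
  \<open>q\<close> of them.\<close>

definition regular_polyhedron :: "nat \<Rightarrow> nat \<Rightarrow> (real^3) set \<Rightarrow> bool" where
  "regular_polyhedron p q P \<longleftrightarrow> polytope P \<and> aff_dim P = 3 \<and>
     (\<exists>r. \<forall>F. F facet_of P \<longrightarrow> regular_polygon p r F) \<and>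
     (\<forall>v \<in> vertices P. card {F. F facet_of P \<and> v \<in> F} = q)"

definition regular_icosahedron :: "(real^3) set \<Rightarrow> bool" where
  "regular_icosahedron P \<longleftrightarrow> regular_polyhedron 3 5 P"

definition regular_dodecahedron :: "(real^3) set \<Rightarrow> bool" where
  "regular_dodecahedron P \<longleftrightarrow> regular_polyhedron 5 3 P"

definition has_circumradius :: "(real^3) set \<Rightarrow> real \<Rightarrow> bool" where
  "has_circumradius P R \<longleftrightarrow> (\<exists>c. \<forall>v \<in> vertices P. dist c v = R)"

text \<open>\<open>S n A M k\<close> is the average of the \<open>k\<close>-th powers of the distances from \<open>M\<close> to
  \<open>A 1, \<dots>, A n\<close>; the argument \<open>k\<close> is the whole exponent \<open>2m\<close> of \<open>S\<close>, not \<open>m\<close>.\<close>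

definition S :: "nat \<Rightarrow> (nat \<Rightarrow> real^3) \<Rightarrow> real^3 \<Rightarrow> nat \<Rightarrow> real" where
  "S n A M k = (1 / real n) * (\<Sum>i = 1..n. dist M (A i) ^ k)"

end

theory Submission imports Defs begin

text \<open>The facets around a vertex, together with the sphere on which the vertices lie, determine how
  a facet continues across an edge by a linear rule. For triangles \<open>a b d\<close>, \<open>a b d'\<close> seen from the
  centre it is \<open>d + d' = s (a + b)\<close>, and five triangles closing up around a vertex force
  \<open>s\<^sup>2 + s = 1\<close>; for pentagons it is \<open>a + d + f = \<surd>5 b\<close> for the three neighbours of \<open>b\<close>. Following the rule
  produces the 12 or 20 classical points in an orthogonal frame, and since this is the
  total number of vertices there are no others. Both point sets are spherical 5-designs, and the
  four identities only involve moments of order at most 5. The second root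
  \<open>s = - (1 + \<surd>5) / 2\<close>, which belongs to the great icosahedron, need not be excluded: it leads to
  the same vertex set up to conjugation of \<open>\<surd>5\<close>.\<close>

section \<open>Faces of polytopes and the geometry of three-space\<close>

text \<open>The hypotheses are local and metric: the shape of the facets and their number at each
  vertex, without any symmetry. The centre of the sphere makes them linear. Measured from it,
  vertices are vectors of equal length, the inner product of two neighbours depends only on the edge
  length, and a vector of \<open>real^3\<close> vanishes once it is orthogonal to three vectors with
  nonzero Gram determinant; each continuation rule is such a vanishing. What remains of
  combinatorics is the graph that joins two neighbours of a vertex when they share a facet with it.
  It has to be a single cycle, of length five for triangles and three for pentagons, before the rule
  can be composed around the vertex. The ratio of edge length to \<open>R\<close> is not given;
  closing the cycle fixes it by a quadratic equation. For triangles both roots are conjugate.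
  Pentagons bring along the ratio \<open>golden\<close> of diagonal to side, and one root of their
  quadratic is edge length zero.\<close>

lemma extreme_points_cosphere:
  fixes c :: "'a::euclidean_space"
  assumes "\<And>p. p \<in> W \<Longrightarrow> dist c p = r"
  shows "{v. v extreme_point_of (convex hull W)} = W"
proof
  show "{v. v extreme_point_of (convex hull W)} \<subseteq> W"
    using extreme_point_of_convex_hull by blast
  show "W \<subseteq> {v. v extreme_point_of (convex hull W)}"
  proof
    fix p assume p: "p \<in> W"
    have sub: "convex hull W \<subseteq> cball c r"
      by (rule hull_minimal) (use assms in auto)
    \<comment> \<open>Balls are strictly convex: an inner point of a segment is strictly closer to
      \<open>c\<close> than one of the ends, and both ends lie in the ball of radius
      \<open>r\<close>.\<close>
    have "p \<notin> open_segment a b" if ab: "a \<in> convex hull W" "b \<in> convex hull W" for a b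
    proof
      assume "p \<in> open_segment a b"
      from dist_decreases_open_segment[OF this, of c] show False
        using assms[OF p] sub ab by (force simp: subset_iff)
    qed
    then show "p \<in> {v. v extreme_point_of (convex hull W)}"
      using p by (auto simp: extreme_point_of_def hull_inc)
  qed
qed

lemma vertices_facet:
  assumes "F facet_of P"
  shows "vertices F = vertices P \<inter> F"
  using extreme_point_of_face[OF facet_of_imp_face_of[OF assms]] by (auto simp: vertices_def)

text \<open>That an edge lies in no third facet is never used: for triangles it follows from the metric
  rule across an edge, for pentagons from the number of facets at a vertex.\<close>

lemma edge_in_second_facet:
  assumes "polytope P" "aff_dim P = 3" "F facet_of P" "convex hull {v, x} face_of F"
  obtains G where "G facet_of P" "G \<noteq> F" "v \<in> G" "x \<in> G"
proof -
  let ?E = "convex hull {v, x}"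
  have EP: "?E face_of P"
    using assms(3,4) facet_of_imp_face_of face_of_trans by blast
  have "aff_dim ?E \<le> 1"
    by (simp add: aff_dim_convex_hull)
  then have ne: "?E \<noteq> P" "?E \<noteq> F"
    using assms(2,3) by (auto simp: facet_of_def)
  \<comment> \<open>A proper face is the intersection of the facets through it; were
    \<open>F\<close> the only one, \<open>?E\<close> would equal \<open>F\<close>, against the
    dimension count.\<close>
  have "?E = \<Inter>{F. F facet_of P \<and> ?E \<subseteq> F}"
    by (rule face_of_polyhedron) (use assms EP ne polytope_imp_polyhedron in auto)
  moreover have "?E \<subseteq> F"
    using assms(4) face_of_imp_subset by blast
  ultimately obtain G where "G facet_of P" "G \<noteq> F" "?E \<subseteq> G"
    using ne(2) assms(3)
    by (metis (mono_tags, lifting) Inf_lower Inter_greatest mem_Collect_eq order_antisym order_refl)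
  then show ?thesis
    using that by (meson hull_subset insert_subset subset_trans)
qed

text \<open>\<open>n\<close> is normal to a hyperplane that contains the segment and has all other
  generating points strictly on one side.\<close>

lemma segment_face_of_hull:
  fixes W :: "'a::euclidean_space set"
  assumes "finite W" "v \<in> W" "x \<in> W" "n \<bullet> (x - v) = 0"
    and "\<And>z. z \<in> W - {v, x} \<Longrightarrow> 0 < n \<bullet> (z - v)"
  shows "convex hull {v, x} face_of convex hull W"
proof (rule face_of_convex_hulls)
  have "affine hull {v, x} \<subseteq> {z. n \<bullet> z = n \<bullet> v}"
    by (rule hull_minimal) (use assms(4) in \<open>auto simp: inner_diff_right affine_hyperplane\<close>)
  moreover have "convex hull (W - {v, x}) \<subseteq> {z. n \<bullet> z > n \<bullet> v}"
    by (rule hull_minimal) (use assms(5) in \<open>auto simp: inner_diff_right convex_halfspace_gt\<close>)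
  ultimately show "affine hull {v, x} \<inter> convex hull (W - {v, x}) = {}"
    by fastforce
qed (use assms in auto)

text \<open>The vector is \<open>X \<bullet> X\<close> times the component of \<open>Y\<close>
  orthogonal to \<open>X\<close>. For \<open>X\<close> and \<open>Y\<close> along the two edges at a
  corner of a polygon it is the inward normal of the edge \<open>X\<close> within the plane of the
  polygon.\<close>

lemma inner_orthogonal_part_pos:
  fixes X Y :: "'a::real_inner"
  assumes "\<bar>X \<bullet> Y\<bar> < norm X * norm Y"
  shows "((X \<bullet> X) *\<^sub>R Y - (X \<bullet> Y) *\<^sub>R X) \<bullet> X = 0" "((X \<bullet> X) *\<^sub>R Y - (X \<bullet> Y) *\<^sub>R X) \<bullet> Y > 0"
proof -
  show "((X \<bullet> X) *\<^sub>R Y - (X \<bullet> Y) *\<^sub>R X) \<bullet> X = 0"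
    by (simp only: inner_diff_left inner_scaleR_left inner_commute[of Y X]) simp
  have "(X \<bullet> Y)\<^sup>2 < (norm X * norm Y)\<^sup>2"
    using assms by (metis abs_ge_zero abs_mult abs_norm_cancel abs_square_less_1 power2_abs power_strict_mono zero_less_numeral)
  then show "((X \<bullet> X) *\<^sub>R Y - (X \<bullet> Y) *\<^sub>R X) \<bullet> Y > 0"
    by (simp only: inner_diff_left inner_scaleR_left power_mult_distrib power2_norm_eq_inner)
      (simp add: power2_eq_square)
qed

text \<open>The polynomial is the Gram determinant of \<open>p\<close>, \<open>q\<close>, \<open>b\<close>.\<close>

lemma orthogonal_gram3:
  fixes p q b z :: "real^3"
  assumes "z \<bullet> p = 0" "z \<bullet> q = 0" "z \<bullet> b = 0"
    and "(p \<bullet> p) * (q \<bullet> q) * (b \<bullet> b) + 2 * (p \<bullet> q) * (q \<bullet> b) * (p \<bullet> b)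
       - (p \<bullet> p) * (q \<bullet> b)\<^sup>2 - (q \<bullet> q) * (p \<bullet> b)\<^sup>2 - (b \<bullet> b) * (p \<bullet> q)\<^sup>2 \<noteq> 0" (is "?g \<noteq> 0")
  shows "z = 0"
proof -
  have g: "?g = (det (vector [p, q, b]))\<^sup>2"
    by (simp add: det_3 inner_vec_def sum_3 power2_eq_square) (simp add: algebra_simps)
  then have "det (vector [p, q, b] :: real^3^3) \<noteq> 0"
    using assms(4) by simp
  moreover have "(vector [p, q, b] :: real^3^3) *v z = 0"
    using assms(1-3) by (simp add: vec_eq_iff forall_3 matrix_vector_mult_def inner_vec_def mult.commute sum_3)
  ultimately show "z = 0"
    by (metis invertible_det_nz matrix_left_invertible_ker invertible_left_inverse)
qed

text \<open>The defect \<open>z\<close> of the orthogonal expansion is orthogonal to all three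
  vectors, whose Gram determinant is \<open>K ^ 3\<close>.\<close>

lemma orthogonal_triple_parseval:
  fixes M :: "real^3"
  assumes "e1 \<bullet> e2 = 0" "e1 \<bullet> e3 = 0" "e2 \<bullet> e3 = 0"
    and "e1 \<bullet> e1 = K" "e2 \<bullet> e2 = K" "e3 \<bullet> e3 = K" "K \<noteq> 0"
  shows "K * (M \<bullet> M) = (M \<bullet> e1)\<^sup>2 + (M \<bullet> e2)\<^sup>2 + (M \<bullet> e3)\<^sup>2"
proof -
  define z where "z = K *\<^sub>R M - (M \<bullet> e1) *\<^sub>R e1 - (M \<bullet> e2) *\<^sub>R e2 - (M \<bullet> e3) *\<^sub>R e3"
  have "z \<bullet> e1 = 0" "z \<bullet> e2 = 0" "z \<bullet> e3 = 0"
    using assms by (auto simp: z_def inner_diff_left inner_commute algebra_simps)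
  then have "z = 0"
    by (rule orthogonal_gram3) (use assms in \<open>auto simp: power2_eq_square\<close>)
  then have "z \<bullet> M = 0" by simp
  then show ?thesis
    by (simp add: z_def inner_diff_left inner_commute power2_eq_square algebra_simps)
qed

section \<open>Regular triangles and pentagons\<close>

definition golden :: real where "golden = (1 + sqrt 5) / 2"

lemma golden_sq: "golden * golden = golden + 1"
  by (simp add: golden_def field_simps)

lemma golden_bounds: "1 < golden" "golden < 2"
proof -
  have "1 < sqrt 5" "sqrt 5 < 3"
    using real_sqrt_less_mono[of 1 5] real_sqrt_less_mono[of 5 9] by simp_all
  then show "1 < golden" "golden < 2" by (simp_all add: golden_def)
qed

text \<open>Five times the angle is a full turn, so its triple and its double have the same cosine.
  The resulting cubic has the root 1; the other two are \<open>(golden - 1) / 2\<close> and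
  \<open>- golden / 2\<close>, and the sign decides.\<close>

lemma cos_72: "cos (2 * pi / 5) = (golden - 1) / 2"
proof -
  let ?x = "2 * pi / 5"
  define c where "c = cos ?x"
  have "3 * ?x = 2 * pi - 2 * ?x"
    by (simp add: field_simps)
  then have "cos (3 * ?x) = cos (2 * pi - 2 * ?x)"
    by (rule arg_cong)
  also have "\<dots> = cos (2 * ?x)"
    unfolding cos_diff by simp
  finally have "4 * c ^ 3 - 3 * c = 2 * c\<^sup>2 - 1"
    unfolding c_def cos_treble_cos cos_double_cos .
  then have "(c - 1) * (4 * c\<^sup>2 + 2 * c - 1) = 0"
    by algebra
  moreover have "c < cos 0"
    unfolding c_def by (rule cos_monotone_0_pi) auto
  ultimately have q: "4 * c\<^sup>2 + 2 * c - 1 = 0"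
    by simp
  have "0 < c"
    unfolding c_def by (rule cos_gt_zero_pi) (auto simp: field_simps)
  moreover have "(2 * c + 1 - golden) * (2 * c + golden) = 0"
    using q golden_sq by algebra
  ultimately show ?thesis
    using golden_bounds unfolding c_def[symmetric] by auto
qed

text \<open>Meant for four consecutive corners of a regular pentagon: the diagonal from
  \<open>A\<close> to \<open>D\<close> is parallel to the side from \<open>B\<close> to
  \<open>C\<close> and \<open>golden\<close> times as long.\<close>

definition trapezium :: "'a::real_vector \<Rightarrow> 'a \<Rightarrow> 'a \<Rightarrow> 'a \<Rightarrow> bool" where
  "trapezium A B C D \<longleftrightarrow> D = A + golden *\<^sub>R (C - B)"

lemma trapezium_flip: "trapezium A B C D \<longleftrightarrow> trapezium D C B A"
  by (auto simp: trapezium_def algebra_simps)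

text \<open>The conditions are redundant so that the list is invariant under the symmetries of the
  pentagon: rotating or reversing the labels only permutes it.\<close>

definition pentagon :: "real \<Rightarrow> 'a::real_normed_vector \<Rightarrow> 'a \<Rightarrow> 'a \<Rightarrow> 'a \<Rightarrow> 'a \<Rightarrow> bool" where
  "pentagon l A B C D E \<longleftrightarrow> l > 0 \<and>
     trapezium A B C D \<and> trapezium B C D E \<and> trapezium C D E A \<and>
     trapezium D E A B \<and> trapezium E A B C \<and>
     dist A B = l \<and> dist B C = l \<and> dist C D = l \<and> dist D E = l \<and> dist E A = l \<and>
     dist A C = golden * l \<and> dist B D = golden * l \<and> dist C E = golden * l \<and>
     dist D A = golden * l \<and> dist E B = golden * l"

lemma pentagon_rotate: "pentagon l A B C D E \<Longrightarrow> pentagon l B C D E A"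
  by (simp add: pentagon_def)

lemma pentagon_flip: "pentagon l A B C D E \<Longrightarrow> pentagon l E D C B A"
  unfolding pentagon_def using trapezium_flip dist_commute by metis

text \<open>Diagonals have length \<open>golden * l\<close>, different from \<open>l\<close>, so
  \<open>x\<close>, \<open>y\<close> is one of the ten directed sides; the five rotations, each
  followed or not by a reversal, bring all of them to the front.\<close>

lemma pentagon_through_edge:
  assumes "pentagon l A B C D E" "x \<in> {A, B, C, D, E}" "y \<in> {A, B, C, D, E}" "dist x y = l"
  obtains C' D' E' where "pentagon l x y C' D' E'" "{x, y, C', D', E'} = {A, B, C, D, E}"
proof -
  have l: "l > 0" "golden * l \<noteq> l" "golden * l \<noteq> 0"
    using assms(1) golden_bounds by (auto simp: pentagon_def)
  note r = pentagon_rotate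
  note p1 = assms(1)
  note p2 = r[OF p1] note p3 = r[OF p2] note p4 = r[OF p3] note p5 = r[OF p4]
  note ps = p1 p2 p3 p4 p5
  note qs = ps[THEN pentagon_flip]
  have d: "dist A B = l" "dist B C = l" "dist C D = l" "dist D E = l" "dist E A = l"
     "dist A C = golden * l" "dist B D = golden * l" "dist C E = golden * l"
     "dist D A = golden * l" "dist E B = golden * l"
    using p1 by (simp_all add: pentagon_def)
  note d' = d[THEN trans[OF dist_commute]]
  have "(x, y) \<in> {(A,B),(B,C),(C,D),(D,E),(E,A),(B,A),(C,B),(D,C),(E,D),(A,E)}"
    using assms(2-4) l by (elim insertE emptyE) (simp_all add: d d')
  moreover have "\<exists>C' D' E'. pentagon l x y C' D' E' \<and> {x, y, C', D', E'} = {A, B, C, D, E}"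
    if "pentagon l x y a b c" "{x, y, a, b, c} = {A, B, C, D, E}" for a b c
    using that by blast
  note w = this
  ultimately have "\<exists>C' D' E'. pentagon l x y C' D' E' \<and> {x, y, C', D', E'} = {A, B, C, D, E}"
    using ps qs by (elim insertE emptyE Pair_inject; intro w; simp; fast)
  then show ?thesis using that by blast
qed

lemma pentagon_corner:
  assumes "pentagon l A B C D E" "x \<in> {A, B, C, D, E}"
  obtains y C' D' E' where "pentagon l y x C' D' E'" "{y, x, C', D', E'} = {A, B, C, D, E}"
proof -
  have "\<exists>y\<in>{A, B, C, D, E}. dist y x = l"
    using assms by (auto simp: pentagon_def dist_commute)
  then show ?thesis
    using pentagon_through_edge[OF assms(1) _ assms(2)] that by metis
qed

lemma dist_in_plane:
  fixes u w :: "'a::real_inner"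
  assumes "norm u = 1" "norm w = 1" "u \<bullet> w = 0" "0 < r"
  shows "dist (c + r *\<^sub>R (a *\<^sub>R u + b *\<^sub>R w)) (c + r *\<^sub>R (a' *\<^sub>R u + b' *\<^sub>R w))
       = r * sqrt ((a - a')\<^sup>2 + (b - b')\<^sup>2)"
proof -
  have uw: "u \<bullet> u = 1" "w \<bullet> w = 1" "w \<bullet> u = 0"
    using assms by (auto simp: norm_eq_1 inner_commute)
  have "norm ((a - a') *\<^sub>R u + (b - b') *\<^sub>R w) = sqrt ((a - a')\<^sup>2 + (b - b')\<^sup>2)"
    by (simp add: norm_eq_sqrt_inner inner_add_left inner_add_right uw assms(3) power2_eq_square)
  moreover have "(c + r *\<^sub>R (a *\<^sub>R u + b *\<^sub>R w)) - (c + r *\<^sub>R (a' *\<^sub>R u + b' *\<^sub>R w))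
       = r *\<^sub>R ((a - a') *\<^sub>R u + (b - b') *\<^sub>R w)"
    by (simp add: algebra_simps)
  ultimately show ?thesis
    using assms(4) by (simp add: dist_norm)
qed

lemma dist_centre_in_plane:
  fixes u w :: "'a::real_inner"
  assumes "norm u = 1" "norm w = 1" "u \<bullet> w = 0" "0 < r" "a\<^sup>2 + b\<^sup>2 = 1"
  shows "dist c (c + r *\<^sub>R (a *\<^sub>R u + b *\<^sub>R w)) = r"
  using dist_in_plane[OF assms(1-4), of c 0 0 a b] assms(5) by simp

lemma regular_triangle:
  assumes "regular_polygon 3 r F"
  obtains A B C where "F = convex hull {A, B, C}" "vertices F = {A, B, C}"
    "0 < r" "dist A B = sqrt 3 * r" "dist B C = sqrt 3 * r" "dist C A = sqrt 3 * r"
proof -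
  obtain c u w where uw: "norm u = 1" "norm w = 1" "u \<bullet> w = 0" and r: "0 < r"
    and F: "F = convex hull ((\<lambda>k. c + r *\<^sub>R (cos (2 * pi * real k / real 3) *\<^sub>R u
                                  + sin (2 * pi * real k / real 3) *\<^sub>R w)) ` {..<3})"
    using assms unfolding regular_polygon_def by blast
  define p where "p a b = c + r *\<^sub>R (a *\<^sub>R u + b *\<^sub>R w)" for a b
  have t: "4 * pi / 3 = 2 * pi - 2 * pi / 3" by simp
  have c4: "cos (4 * pi / 3) = - 1/2" "sin (4 * pi / 3) = - sqrt 3 / 2"
    unfolding t cos_diff sin_diff by (simp_all add: cos_120 sin_120)
  have "{..<3} = {0, 1, 2 :: nat}" by auto
  then have F': "F = convex hull {p 1 0, p (-1/2) (sqrt 3 / 2), p (-1/2) (- sqrt 3 / 2)}"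
    unfolding F p_def by (simp add: c4 cos_120 sin_120)
  note d = dist_in_plane[OF uw r, of c, folded p_def]
  have V: "vertices F = {p 1 0, p (-1/2) (sqrt 3 / 2), p (-1/2) (- sqrt 3 / 2)}"
    unfolding F' vertices_def
    by (rule extreme_points_cosphere[where r = r])
      (auto simp: power_divide simp del: add_uminus_conv_diff intro!: dist_centre_in_plane[OF uw r, of _ _ c, folded p_def])
  have dl: "dist (p a b) (p a' b') = sqrt 3 * r" if "(a - a')\<^sup>2 + (b - b')\<^sup>2 = 3" for a b a' b'
    unfolding d that by simp
  show ?thesis
    by (intro that[OF F' V r] dl) (simp_all add: power2_eq_square field_simps)
qed

text \<open>In the unit circle the squared side is
  \<open>2 - 2 * cos (2 * pi / 5) = 3 - golden\<close> and the squared diagonal is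
  \<open>2 - 2 * cos (4 * pi / 5) = golden + 2\<close>.\<close>

lemma regular_pentagon:
  assumes "regular_polygon 5 r F"
  obtains A B C D E where "F = convex hull {A, B, C, D, E}" "vertices F = {A, B, C, D, E}"
    "pentagon (sqrt (3 - golden) * r) A B C D E"
proof -
  obtain c u w where uw: "norm u = 1" "norm w = 1" "u \<bullet> w = 0" and r: "0 < r"
    and F: "F = convex hull ((\<lambda>k. c + r *\<^sub>R (cos (2 * pi * real k / real 5) *\<^sub>R u
                                  + sin (2 * pi * real k / real 5) *\<^sub>R w)) ` {..<5})"
    using assms unfolding regular_polygon_def by blast
  define p where "p a b = c + r *\<^sub>R (a *\<^sub>R u + b *\<^sub>R w)" for a b
  define s where "s = sin (2 * pi / 5)"
  let ?c = "(golden - 1) / 2" and ?d = "- golden / 2" and ?t = "(golden - 1) * s"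
  have s: "s * s = (golden + 2) / 4"
    using sin_cos_squared_add[of "2 * pi / 5"] golden_sq
    unfolding cos_72 s_def[symmetric] by (simp add: power2_eq_square field_simps)
  have "4 * pi / 5 = 2 * (2 * pi / 5)" by simp
  then have c2: "cos (4 * pi / 5) = ?d" "sin (4 * pi / 5) = ?t"
    using golden_sq
    by (simp_all only: cos_double_cos sin_double cos_72 s_def) (simp_all add: power2_eq_square field_simps)
  have e: "6 * pi / 5 = 2 * pi - 4 * pi / 5" "8 * pi / 5 = 2 * pi - 2 * pi / 5" by simp_all
  have c3: "cos (6 * pi / 5) = ?d" "sin (6 * pi / 5) = - ?t"
    "cos (8 * pi / 5) = ?c" "sin (8 * pi / 5) = - s"
    unfolding e cos_diff sin_diff by (simp_all add: c2 cos_72 s_def)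
  have "{..<5} = {0, 1, 2, 3, 4 :: nat}" by auto
  then have F': "F = convex hull {p 1 0, p ?c s, p ?d ?t, p ?d (- ?t), p ?c (- s)}"
    unfolding F p_def by (simp add: c2 c3 cos_72 s_def)
  have V: "vertices F = {p 1 0, p ?c s, p ?d ?t, p ?d (- ?t), p ?c (- s)}"
  proof -
    have "?c\<^sup>2 + s\<^sup>2 = 1" using s golden_sq by (simp add: power2_eq_square field_simps)
    moreover have "?t\<^sup>2 = (2 - golden) * (s * s)" using golden_sq by algebra
    then have "?d\<^sup>2 + ?t\<^sup>2 = 1" using golden_sq unfolding s by (simp add: power2_eq_square field_simps)
    ultimately show ?thesis
      unfolding F' vertices_def
      by (intro extreme_points_cosphere[where r = r])
        (auto simp del: add_uminus_conv_diff intro!: dist_centre_in_plane[OF uw r, of _ _ c, folded p_def])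
  qed
  note d = dist_in_plane[OF uw r, of c, folded p_def]
  have diag: "golden * sqrt (3 - golden) = sqrt (golden + 2)"
  proof -
    have "golden * sqrt (3 - golden) = sqrt (golden\<^sup>2 * (3 - golden))"
      using golden_bounds by (simp add: real_sqrt_mult)
    also have "golden\<^sup>2 * (3 - golden) = golden + 2"
      using golden_sq by algebra
    finally show ?thesis .
  qed
  have dl: "dist (p a b) (p a' b') = sqrt (3 - golden) * r" if "(a - a')\<^sup>2 + (b - b')\<^sup>2 = 3 - golden" for a b a' b'
    unfolding d that by simp
  have dd: "dist (p a b) (p a' b') = golden * (sqrt (3 - golden) * r)" if "(a - a')\<^sup>2 + (b - b')\<^sup>2 = golden + 2" for a b a' b'
    unfolding d that mult.assoc[symmetric] diag by simp
  have trap: "trapezium (p a1 b1) (p a3 b3) (p a2 b2) (p a b)"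
    if "a = a1 + golden * (a2 - a3)" "b = b1 + golden * (b2 - b3)" for a b a1 b1 a2 b2 a3 b3
    unfolding that p_def trapezium_def by (simp add: algebra_simps)
  have s4: "4 * (s * s) = golden + 2" using s by simp
  have "pentagon (sqrt (3 - golden) * r) (p 1 0) (p ?c s) (p ?d ?t) (p ?d (- ?t)) (p ?c (- s))"
    unfolding pentagon_def
    proof (intro conjI trap dl dd)
    show "0 < sqrt (3 - golden) * r" using golden_bounds r by simp
  qed (simp_all add: power2_eq_square field_simps, (use golden_sq s4 in algebra)+)
  then show ?thesis
    using F' V that by blast
qed

section \<open>Link graphs\<close>

text \<open>A graph with three edges and no vertex of degree one is a triangle: the path
  \<open>d'\<close>, \<open>a\<close>, \<open>c\<close>, \<open>d\<close> already uses three edges,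
  and the second edge at \<open>d\<close> has to be one of them.\<close>

lemma third_side:
  assumes "card \<E> = 3" and two: "\<And>e. e \<in> \<E> \<Longrightarrow> card e = 2"
    and deg: "\<And>e x. e \<in> \<E> \<Longrightarrow> x \<in> e \<Longrightarrow> \<exists>e'\<in>\<E>. e' \<noteq> e \<and> x \<in> e'"
    and ac: "{a, c} \<in> \<E>"
  obtains d where "d \<noteq> a" "d \<noteq> c" "{c, d} \<in> \<E>" "{d, a} \<in> \<E>"
proof -
  have nb: "\<exists>z. z \<noteq> x \<and> z \<noteq> y \<and> {y, z} \<in> \<E>" if xy: "{x, y} \<in> \<E>" for x y
  proof -
    obtain e where e: "e \<in> \<E>" "e \<noteq> {x, y}" "y \<in> e"
      using deg[OF xy, of y] by blast
    then obtain z where "e = {y, z}" "z \<noteq> y"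
      using two[OF e(1)] by (auto simp: card_2_iff)
    with e show ?thesis by (metis insert_commute)
  qed
  have "{c, a} \<in> \<E>" using ac by (simp add: insert_commute)
  obtain d where d: "d \<noteq> a" "d \<noteq> c" "{c, d} \<in> \<E>" using nb[OF ac] by blast
  obtain d' where d': "d' \<noteq> c" "d' \<noteq> a" "{a, d'} \<in> \<E>" using nb[OF \<open>{c, a} \<in> \<E>\<close>] by blast
  obtain f where f: "f \<noteq> c" "f \<noteq> d" "{d, f} \<in> \<E>" using nb[OF d(3)] by blast
  have "a \<noteq> c" using two[OF ac] by auto
  have "card {{a, c}, {c, d}, {a, d'}} = 3"
    using d d' \<open>a \<noteq> c\<close> not_sym[OF \<open>a \<noteq> c\<close>] by (simp add: doubleton_eq_iff card_insert_if)
  then have "{{a, c}, {c, d}, {a, d'}} = \<E>"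
    using ac d(3) d'(3) assms(1)
    by (metis card_seteq card.infinite empty_subsetI insert_subset order_refl zero_neq_numeral)
  then have "d = d'"
    using f d d' by (auto simp: doubleton_eq_iff)
  then show ?thesis
    using that d d' by (metis insert_commute)
qed

text \<open>Double counting of incidences: every edge has two ends and every vertex lies on exactly
  two edges.\<close>

lemma two_regular_graph_vertices:
  assumes sym: "\<And>x y. E x y \<Longrightarrow> E y x" and irr: "\<And>x. \<not> E x x"
    and fin: "finite {{x, y} | x y. E x y}"
    and deg: "\<And>x y. E x y \<Longrightarrow> \<exists>z. z \<noteq> y \<and> E x z"
    and full: "\<And>x y z w. E x y \<Longrightarrow> E x z \<Longrightarrow> E x w \<Longrightarrow> y = z \<or> y = w \<or> z = w"
  shows "finite {x. \<exists>y. E x y}" "card {x. \<exists>y. E x y} = card {{x, y} | x y. E x y}"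
proof -
  let ?\<E> = "{{x, y} | x y. E x y}" and ?N = "{x. \<exists>y. E x y}"
  have "?N \<subseteq> \<Union>?\<E>" by blast
  moreover have "finite (\<Union>?\<E>)" using fin by auto
  ultimately show fN: "finite ?N" by (rule finite_subset)
  have k: "card {e \<in> ?\<E>. x \<in> e} = 2" if x: "x \<in> ?N" for x
  proof -
    obtain y z where yz: "E x y" "z \<noteq> y" "E x z" using x deg by blast
    have "e = {x, y} \<or> e = {x, z}" if e: "e \<in> ?\<E>" "x \<in> e" for e
    proof -
      obtain w where "e = {x, w}" "E x w" using e sym by auto
      then show ?thesis using full[OF yz(1) yz(3), of w] yz by auto
    qed
    then have "{e \<in> ?\<E>. x \<in> e} = {{x, y}, {x, z}}" using yz by auto
    then show ?thesis using yz by (auto simp: doubleton_eq_iff)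
  qed
  have "(\<Sum>e\<in>?\<E>. card {x \<in> ?N. x \<in> e}) = 2 * card ?N"
    by (rule sum_multicount[OF fin fN]) (use k in blast)
  moreover have "card {x \<in> ?N. x \<in> e} = 2" if e: "e \<in> ?\<E>" for e
  proof -
    obtain x y where xy: "e = {x, y}" "E x y" using e by blast
    then have "{x \<in> ?N. x \<in> e} = {x, y}" using sym by blast
    then show ?thesis using xy irr by (metis card_2_iff)
  qed
  ultimately show "card ?N = card ?\<E>" by simp
qed

text \<open>A graph of this kind is a disjoint union of cycles of length at least three, and five is
  not a sum of two such lengths.\<close>

lemma pentagon_in_two_regular_graph:
  assumes sym: "\<And>x y. E x y \<Longrightarrow> E y x" and irr: "\<And>x. \<not> E x x"
    and card5: "card {{x, y} | x y. E x y} = 5"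
    and deg: "\<And>x y. E x y \<Longrightarrow> \<exists>z. z \<noteq> y \<and> E x z"
    and full: "\<And>x y z w. E x y \<Longrightarrow> E x z \<Longrightarrow> E x w \<Longrightarrow> y = z \<or> y = w \<or> z = w"
    and x01: "E x0 x1"
  obtains x2 x3 x4 where "E x1 x2" "E x2 x3" "E x3 x4" "E x4 x0"
    "x2 \<noteq> x0" "x3 \<noteq> x1" "x4 \<noteq> x2" "x3 \<noteq> x0" "x4 \<noteq> x1"
proof -
  let ?N = "{x. \<exists>y. E x y}"
  have fin: "finite {{x, y} | x y. E x y}" by (rule card_ge_0_finite) (simp only: card5)
  have N: "finite ?N" "card ?N = 5"
    using two_regular_graph_vertices[of E, OF sym irr fin deg full] card5 by (simp_all only:)
  have big: False if "set xs \<subseteq> ?N" "length xs = 6" "distinct xs" for xs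
    using card_mono[OF N(1) that(1)] N(2) that distinct_card[of xs] by simp
  have small: "\<exists>x\<in>?N. x \<notin> set xs" if "length xs < 5" for xs
  proof (rule ccontr)
    assume "\<not> ?thesis"
    then have "?N \<subseteq> set xs" by blast
    then show False
      using card_mono[of "set xs" ?N] card_length[of xs] N that by simp
  qed
  obtain x2 where x2: "x2 \<noteq> x0" "E x1 x2" using deg[OF sym[OF x01]] by blast
  obtain x3 where x3: "x3 \<noteq> x1" "E x2 x3" using deg[OF sym[OF x2(2)]] by blast
  have n1: "x1 \<noteq> x0" "x2 \<noteq> x1" "x3 \<noteq> x2" using x01 x2 x3 irr by auto
  \<comment> \<open>A triangle is saturated, so a fourth vertex and its two neighbours lie outside
    it: six vertices.\<close>
  have "x3 \<noteq> x0"
  proof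
    assume x30: "x3 = x0"
    obtain y0 where y0: "y0 \<in> ?N" "y0 \<notin> {x0, x1, x2}"
      using small[of "[x0, x1, x2]"] by auto
    have out: "b \<notin> {x0, x1, x2}" if "E a b" "a \<notin> {x0, x1, x2}" for a b
      using that x2 x3 x30 x01 n1 full[of x0 x1 x2 a] full[of x1 x0 x2 a] full[of x2 x1 x0 a] sym by auto
    obtain y1 where y1: "E y0 y1" using y0 by blast
    obtain y2 where y2: "E y0 y2" "y2 \<noteq> y1" using deg[OF y1] by blast
    show False
    proof (rule big[of "[x0, x1, x2, y0, y1, y2]"])
      show "set [x0, x1, x2, y0, y1, y2] \<subseteq> ?N" using x01 x2 x3 y1 y2 sym by auto
      show "distinct [x0, x1, x2, y0, y1, y2]"
        using n1 x2(1) y0(2) out[OF y1 y0(2)] out[OF y2(1) y0(2)] y2 y1 irr by auto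
    qed simp
  qed
  obtain x4 where x4: "x4 \<noteq> x2" "E x3 x4" using deg[OF sym[OF x3(2)]] by blast
  have "x4 \<noteq> x1" using full[of x1 x0 x2 x3] sym x01 x2 x3 x4 \<open>x3 \<noteq> x0\<close> n1 by metis
  have n2: "x4 \<noteq> x3" using irr x4 by auto
  \<comment> \<open>A quadrilateral is saturated as well; a fifth vertex together with one neighbour
    outside again gives six.\<close>
  have "x4 \<noteq> x0"
  proof
    assume x40: "x4 = x0"
    obtain y0 where y0: "y0 \<in> ?N" "y0 \<notin> {x0, x1, x2, x3}"
      using small[of "[x0, x1, x2, x3]"] by auto
    have out: "b \<notin> {x0, x1, x2, x3}" if "E a b" "a \<notin> {x0, x1, x2, x3}" for a b
      using that x2 x3 x4 x40 x01 n1 full[of x0 x1 x3 a] full[of x1 x0 x2 a] full[of x2 x1 x3 a]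
        full[of x3 x2 x0 a] sym by auto
    obtain y1 where y1: "E y0 y1" using y0 by blast
    show False
    proof (rule big[of "[x0, x1, x2, x3, y0, y1]"])
      show "set [x0, x1, x2, x3, y0, y1] \<subseteq> ?N" using x01 x2 x3 x4 y1 sym by auto
      show "distinct [x0, x1, x2, x3, y0, y1]"
        using n1 x2(1) x3(1) \<open>x3 \<noteq> x0\<close> y0(2) out[OF y1 y0(2)] y1 irr by auto
    qed simp
  qed
  obtain x5 where x5: "x5 \<noteq> x3" "E x4 x5" using deg[OF sym[OF x4(2)]] by blast
  have n3: "x5 \<noteq> x4" "x5 \<noteq> x1" "x5 \<noteq> x2"
    using irr full[of x1 x0 x2 x4] full[of x2 x1 x3 x4] sym x01 x2 x3 x4 x5 \<open>x4 \<noteq> x1\<close> \<open>x4 \<noteq> x0\<close> n2 n1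
    by metis+
  have "x5 = x0"
  proof (rule ccontr)
    assume x50: "x5 \<noteq> x0"
    show False
    proof (rule big[of "[x0, x1, x2, x3, x4, x5]"])
      show "set [x0, x1, x2, x3, x4, x5] \<subseteq> ?N" using x01 x2 x3 x4 x5 sym by auto
      show "distinct [x0, x1, x2, x3, x4, x5]"
        using n1 n2 n3 x2 x3 x4 x5 \<open>x3 \<noteq> x0\<close> \<open>x4 \<noteq> x1\<close> \<open>x4 \<noteq> x0\<close> x50 by auto
    qed simp
  qed
  then show ?thesis
    using that x2 x3 x4 x5 \<open>x3 \<noteq> x0\<close> \<open>x4 \<noteq> x1\<close> by blast
qed

section \<open>Triangles around a vertex\<close>

locale inscribed_polyhedron =
  fixes P :: "(real^3) set" and c :: "real^3" and R :: real
  assumes polytope: "polytope P" and dim: "aff_dim P = 3"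
    and on_sphere: "\<And>v. v \<in> vertices P \<Longrightarrow> dist c v = R" and R_pos: "0 < R"

locale inscribed_icosahedron = inscribed_polyhedron +
  fixes l :: real
  assumes l_pos: "0 < l"
    and facets: "\<And>F. F facet_of P \<Longrightarrow> \<exists>A B C. F = convex hull {A, B, C} \<and> vertices F = {A, B, C} \<and>
        dist A B = l \<and> dist B C = l \<and> dist C A = l"
    and five: "\<And>v. v \<in> vertices P \<Longrightarrow> card {F. F facet_of P \<and> v \<in> F} = 5"
begin

text \<open>The arguments are positions relative to the centre \<open>c\<close>, which makes the
  rule across an edge homogeneous.\<close>

definition face :: "real^3 \<Rightarrow> real^3 \<Rightarrow> real^3 \<Rightarrow> bool" where
  "face a b d \<longleftrightarrow> convex hull {c + a, c + b, c + d} facet_of P \<and>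
     vertices (convex hull {c + a, c + b, c + d}) = {c + a, c + b, c + d} \<and>
     dist a b = l \<and> dist b d = l \<and> dist d a = l"

definition t where "t = R\<^sup>2 - l\<^sup>2 / 2"

text \<open>\<open>t\<close> is the inner product of adjacent vertices. Taking inner products of
  \<open>d + d' = s *\<^sub>R (a + b)\<close> with \<open>a\<close> gives
  \<open>2 * t = s * (R\<^sup>2 + t)\<close>, hence this value.\<close>

definition s where "s = 2 * t / (R\<^sup>2 + t)"

lemma face_rotate: "face a b d \<Longrightarrow> face b d a"
  by (simp add: face_def insert_commute)

lemma face_sym: "face a b d \<Longrightarrow> face a d b"
  by (simp add: face_def insert_commute dist_commute)

lemma face_vertex: "face a b d \<Longrightarrow> c + a \<in> vertices P"
  using vertices_facet by (auto simp: face_def)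

lemma face_inner_self: "face a b d \<Longrightarrow> a \<bullet> a = R\<^sup>2"
  using on_sphere[OF face_vertex] by (simp add: dist_norm power2_norm_eq_inner[symmetric])

lemma face_inner: assumes "face a b d" shows "a \<bullet> b = t"
proof -
  have "(a - b) \<bullet> (a - b) = l\<^sup>2"
    using assms by (simp add: face_def dist_norm power2_norm_eq_inner[symmetric])
  then show ?thesis
    using face_inner_self[OF assms] face_inner_self[OF face_rotate[OF assms]]
    by (simp add: t_def algebra_simps inner_commute)
qed

lemma face_distinct: "face a b d \<Longrightarrow> a \<noteq> b"
  using l_pos by (auto simp: face_def)

lemma facet_at_vertex:
  assumes F: "F facet_of P" and a: "c + a \<in> vertices P" "c + a \<in> F"
  obtains b d where "face a b d" "F = convex hull {c + a, c + b, c + d}"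
proof -
  obtain A B C where ABC: "F = convex hull {A, B, C}" "vertices F = {A, B, C}"
    "dist A B = l" "dist B C = l" "dist C A = l"
    using facets[OF F] by blast
  have "c + a \<in> {A, B, C}"
    using a vertices_facet[OF F] ABC by auto
  then have "\<exists>B' C'. {c + a, B', C'} = {A, B, C} \<and> dist (c + a) B' = l \<and> dist B' C' = l \<and> dist C' (c + a) = l"
    using ABC(3-5) by (elim insertE emptyE) (auto intro: exI[of _ A] exI[of _ B] exI[of _ C])
  then obtain B' C' where B': "{c + a, B', C'} = {A, B, C}" "dist (c + a) B' = l" "dist B' C' = l" "dist C' (c + a) = l"
    by blast
  have "face a (B' - c) (C' - c)"
    using B' ABC F by (simp add: face_def dist_norm algebra_simps)
  then show ?thesis
    using that[of "B' - c" "C' - c"] B' ABC by simp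
qed

text \<open>The angle of the triangle gives strict Cauchy-Schwarz for \<open>X\<close> and
  \<open>Y\<close>, so the inward normal exhibits the edge as a face. The second facet through it is
  then relabelled to start with \<open>a\<close> and \<open>b\<close>.\<close>

lemma face_across_edge:
  assumes f: "face a b d"
  obtains d' where "d' \<noteq> d" "face a b d'"
proof -
  let ?A = "c + a" and ?B = "c + b" and ?D = "c + d"
  let ?F = "convex hull {?A, ?B, ?D}"
  have i: "a \<bullet> a = R\<^sup>2" "b \<bullet> b = R\<^sup>2" "d \<bullet> d = R\<^sup>2" "a \<bullet> b = t" "b \<bullet> d = t" "d \<bullet> a = t" "a \<bullet> d = t" "b \<bullet> a = t"
    using f face_rotate face_inner face_inner_self by (metis inner_commute)+
  have F: "?F facet_of P" using f by (simp add: face_def)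
  define X Y where "X = b - a" and "Y = d - a"
  have "\<bar>X \<bullet> Y\<bar> < norm X * norm Y"
  proof -
    have "norm X = l" "norm Y = l"
      using f by (simp_all add: X_def Y_def face_def dist_norm norm_minus_commute)
    moreover have "X \<bullet> Y = l\<^sup>2 / 2"
      by (simp add: X_def Y_def inner_diff_left inner_diff_right i t_def)
    moreover have "0 < l\<^sup>2" using l_pos by simp
    ultimately show ?thesis by (simp add: power2_eq_square)
  qed
  note n = inner_orthogonal_part_pos[OF this]
  have "convex hull {?A, ?B} face_of ?F"
    by (rule segment_face_of_hull[where n = "(X \<bullet> X) *\<^sub>R Y - (X \<bullet> Y) *\<^sub>R X"])
      (use n in \<open>auto simp: X_def Y_def\<close>)
  then obtain G where G: "G facet_of P" "G \<noteq> ?F" "?A \<in> G" "?B \<in> G"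
    using edge_in_second_facet[OF polytope dim F] by metis
  obtain b' d' where b': "face a b' d'" "G = convex hull {?A, c + b', c + d'}"
    using facet_at_vertex[OF G(1) face_vertex[OF f] G(3)] by blast
  have "?B \<in> vertices G"
    using vertices_facet[OF G(1)] face_vertex[OF face_rotate[OF f]] G(4) by blast
  then have "b = b' \<or> b = d'"
    using b' face_distinct[OF f] by (auto simp: face_def)
  then show ?thesis
  proof
    assume "b = b'"
    then show ?thesis using that[of d'] b' G(2) by auto
  next
    assume b: "b = d'"
    then have "face a b b'" using face_sym[OF b'(1)] by simp
    moreover have "G = convex hull {?A, ?B, c + b'}" using b'(2) b by (simp add: insert_commute)
    ultimately show ?thesis using that[of b'] G(2) by auto
  qed
qed

text \<open>The squared length of \<open>a + b + d\<close> is nonnegative, so \<open>t\<close> is at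
  least \<open>- R\<^sup>2 / 2\<close>. The bounds make \<open>R\<^sup>2 + t\<close> and
  \<open>R\<^sup>2 - t\<close> invertible.\<close>

lemma t_bounds: assumes "face a b d" shows "t < R\<^sup>2" "- R\<^sup>2 < t"
proof -
  show "t < R\<^sup>2" using l_pos by (simp add: t_def)
  have i: "a \<bullet> a = R\<^sup>2" "b \<bullet> b = R\<^sup>2" "d \<bullet> d = R\<^sup>2" "a \<bullet> b = t" "b \<bullet> d = t" "d \<bullet> a = t" "a \<bullet> d = t" "b \<bullet> a = t" "d \<bullet> b = t"
    using assms face_rotate face_inner face_inner_self by (metis inner_commute)+
  have "0 \<le> (a + b + d) \<bullet> (a + b + d)" by simp
  then have "0 \<le> R\<^sup>2 + 2 * t" by (simp add: inner_add_left inner_add_right i)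
  moreover have "0 < R\<^sup>2" using R_pos by simp
  ultimately show "- R\<^sup>2 < t" by linarith
qed

text \<open>The vector \<open>z\<close> is orthogonal to \<open>a\<close> and \<open>b\<close> by
  the choice of \<open>s\<close>, and to \<open>d - d'\<close> because \<open>d\<close> and
  \<open>d'\<close> have equal length and equal inner products with \<open>a\<close> and
  \<open>b\<close>. The Gram determinant of these three is
  \<open>(R\<^sup>2 - t) * (R\<^sup>2 + t)\<close> times the squared length of
  \<open>d - d'\<close>.\<close>

lemma face_opposite:
  assumes "face a b d" "face a b d'" "d' \<noteq> d"
  shows "d' = s *\<^sub>R (a + b) - d"
proof -
  have i: "a \<bullet> a = R\<^sup>2" "b \<bullet> b = R\<^sup>2" "d \<bullet> d = R\<^sup>2" "d' \<bullet> d' = R\<^sup>2" "a \<bullet> b = t" "b \<bullet> d = t" "d \<bullet> a = t"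
    "b \<bullet> d' = t" "d' \<bullet> a = t"
    using assms face_rotate face_inner face_inner_self by metis+
  note i' = i inner_commute[of b a] inner_commute[of d b] inner_commute[of a d] inner_commute[of d' b] inner_commute[of a d']
  note tb = t_bounds[OF assms(1)]
  define z where "z = d + d' - s *\<^sub>R (a + b)"
  have st: "s * (R\<^sup>2 + t) = 2 * t" using tb by (simp add: s_def)
  have z: "z \<bullet> a = 0" "z \<bullet> b = 0" "z \<bullet> (d - d') = 0"
    using st by (simp_all add: z_def inner_add_left inner_diff_left inner_diff_right inner_add_right i' inner_commute[of d' d] algebra_simps)
  have "z = 0"
  proof (rule orthogonal_gram3[OF z])
    have o: "a \<bullet> (d - d') = 0" "b \<bullet> (d - d') = 0"
      by (simp_all add: inner_diff_right i')
    have "(R\<^sup>2 - t) * (R\<^sup>2 + t) * ((d - d') \<bullet> (d - d')) \<noteq> 0"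
      using tb assms(3) by simp
    then show "(a \<bullet> a) * (b \<bullet> b) * ((d - d') \<bullet> (d - d')) + 2 * (a \<bullet> b) * (b \<bullet> (d - d')) * (a \<bullet> (d - d'))
       - (a \<bullet> a) * (b \<bullet> (d - d'))\<^sup>2 - (b \<bullet> b) * (a \<bullet> (d - d'))\<^sup>2 - ((d - d') \<bullet> (d - d')) * (a \<bullet> b)\<^sup>2 \<noteq> 0"
      by (simp only: o) (simp add: i' power2_eq_square algebra_simps)
  qed
  then show ?thesis by (simp add: z_def algebra_simps)
qed

lemma face_flip: assumes "face a b d" shows "face a b (s *\<^sub>R (a + b) - d)"
  using face_across_edge[OF assms] face_opposite[OF assms] by metis

text \<open>Facets through \<open>a\<close> correspond to edges of its link: the extreme points of
  the facet, with \<open>a\<close> removed, give the edge back.\<close>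

lemma card_link:
  assumes "face a b d"
  shows "card {{x, y} | x y. face a x y} = 5"
proof -
  let ?\<E> = "{{x, y} | x y. face a x y}"
  let ?f = "\<lambda>e. convex hull ((+) c ` insert a e)"
  have v: "vertices (?f e) = (+) c ` insert a e" "a \<notin> e" if e: "e \<in> ?\<E>" for e
  proof -
    obtain x y where xy: "e = {x, y}" "face a x y" using e by blast
    then show "vertices (?f e) = (+) c ` insert a e" by (simp add: face_def)
    show "a \<notin> e" using xy face_distinct[OF xy(2)] face_distinct[OF face_sym[OF xy(2)]] by simp
  qed
  have "inj_on ?f ?\<E>"
  proof (rule inj_onI)
    fix e e' assume e: "e \<in> ?\<E>" "e' \<in> ?\<E>" "?f e = ?f e'"
    have "(+) c ` insert a e = (+) c ` insert a e'"
      by (rule box_equals[OF arg_cong[OF e(3)] v(1)[OF e(1)] v(1)[OF e(2)]])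
    then have "insert a e = insert a e'"
      by (rule inj_image_eq_iff[THEN iffD1, rotated]) simp
    then show "e = e'" using v(2)[OF e(1)] v(2)[OF e(2)] insert_ident by metis
  qed
  then have "card (?f ` ?\<E>) = card ?\<E>" by (rule card_image)
  moreover have "?f ` ?\<E> = {F. F facet_of P \<and> c + a \<in> F}"
  proof
    show "?f ` ?\<E> \<subseteq> {F. F facet_of P \<and> c + a \<in> F}"
      by (auto simp: face_def hull_inc)
    show "{F. F facet_of P \<and> c + a \<in> F} \<subseteq> ?f ` ?\<E>"
    proof
      fix F assume "F \<in> {F. F facet_of P \<and> c + a \<in> F}"
      then obtain x y where "face a x y" "F = convex hull {c + a, c + x, c + y}"
        using facet_at_vertex[OF _ face_vertex[OF assms]] by blast
      then show "F \<in> ?f ` ?\<E>" by (auto intro!: image_eqI[of _ _ "{x, y}"])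
    qed
  qed
  ultimately show ?thesis
    using five[OF face_vertex[OF assms]] by (simp only:)
qed

text \<open>By uniqueness across an edge the link of \<open>a\<close> is two-regular, hence a
  five-cycle, along which \<open>x(i-1) + x(i+1) = s (a + x(i))\<close>. The two solutions are twice
  the cosines of the angles of pentagon and pentagram, 72 and 144 degrees.\<close>

lemma s_eq: assumes "face a x0 x1" shows "s * s + s = 1"
proof -
  have full: "y = z \<or> y = w \<or> z = w" if f: "face a x y" "face a x z" "face a x w" for x y z w
    using face_opposite[OF f(1,2)] face_opposite[OF f(1,3)] by auto
  note sym = face_sym[of a]
  obtain x2 x3 x4 where x: "face a x1 x2" "face a x2 x3" "face a x3 x4" "face a x4 x0"
    "x2 \<noteq> x0" "x3 \<noteq> x1" "x4 \<noteq> x2" "x3 \<noteq> x0" "x4 \<noteq> x1"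
  proof (rule pentagon_in_two_regular_graph[of "face a" x0 x1])
    show "face a y x" if "face a x y" for x y
      by (rule sym[OF that])
    show "\<not> face a x x" for x
      using face_distinct[OF face_rotate] by blast
    show "\<exists>z. z \<noteq> y \<and> face a x z" if "face a x y" for x y
      using face_across_edge[OF that] by metis
    show "face a x0 x1" by fact
    show "card {{x, y} | x y. face a x y} = 5" by (rule card_link[OF assms])
  qed (rule full)
  have "x1 + x3 = s *\<^sub>R (a + x2)" "x0 + x3 = s *\<^sub>R (a + x4)"
    using face_opposite[OF sym[OF x(1)] x(2) x(6)] face_opposite[OF x(4) sym[OF x(3)]] x(8)
    by (simp_all add: algebra_simps)
  \<comment> \<open>Subtraction eliminates \<open>x3\<close> and \<open>a\<close>. Since also
    \<open>x2 - x4\<close> equals \<open>s + 1\<close> times \<open>x1 - x0\<close>, the nonzero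
    vector \<open>x1 - x0\<close> is multiplied by \<open>s * (s + 1)\<close> and stays the
    same.\<close>
  then have "(x1 + x3) - (x0 + x3) = s *\<^sub>R (x2 - x4)"
    by (simp add: algebra_simps)
  moreover have "x2 = s *\<^sub>R (a + x1) - x0" "x4 = s *\<^sub>R (a + x0) - x1"
    using face_opposite[OF sym[OF assms] x(1,5)] face_opposite[OF assms sym[OF x(4)] x(9)] by simp_all
  ultimately have "x1 - x0 = s *\<^sub>R (s *\<^sub>R (x1 - x0) + (x1 - x0))"
    by (simp add: algebra_simps)
  then have "(s * s + s - 1) *\<^sub>R (x1 - x0) = 0"
    by (simp add: algebra_simps)
  moreover have "x1 \<noteq> x0" using face_distinct[OF face_rotate[OF assms]] by simp
  ultimately show ?thesis by simp
qed

end

section \<open>Moments of the standard vertex sets\<close>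

text \<open>The parameter \<open>p\<close> is meant to be either root of \<open>p\<^sup>2 = p + 1\<close>, so that \<open>p - 1 = 1 / p\<close>.\<close>

definition icosahedron_points :: "real \<Rightarrow> (real \<times> real \<times> real) list" where
  "icosahedron_points p = [(0, 1, p), (0, -1, p), (p, 0, 1), (-p, 0, 1), (1, -p, 0), (1, p, 0), (-1, -p, 0), (-1, p, 0), (p, 0, -1), (-p, 0, -1), (0, -1, -p), (0, 1, -p)]"

text \<open>The eight vertices of a cube and the cyclic permutations of \<open>(0, 1/p, p)\<close>
  with all signs.\<close>

definition dodecahedron_points :: "real \<Rightarrow> (real \<times> real \<times> real) list" where
  "dodecahedron_points p = [(0, p - 1, p), (1, 1, 1), (p - 1, p, 0), (1 - p, p, 0), (p, 0, p - 1), (-1, 1, 1), (1, 1, -1), (p, 0, 1 - p), (0, 1 - p, p), (1, -1, 1), (-1, 1, -1), (0, p - 1, -p), (-p, 0, p - 1), (-1, -1, 1), (-p, 0, 1 - p), (1, -1, -1), (p - 1, -p, 0), (0, 1 - p, -p), (1 - p, -p, 0), (-1, -1, -1)]"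

lemma golden_root_neq:
  assumes "p * p = p + (1::real)"
  shows "p \<noteq> 0" "p \<noteq> 1" "p \<noteq> - 1" "p \<noteq> 2" "p * 2 \<noteq> 1"
proof -
  show "p * 2 \<noteq> 1"
  proof
    assume "p * 2 = 1"
    then have "p = 1 / 2" by simp
    show False using assms unfolding \<open>p = 1 / 2\<close> by simp
  qed
qed (use assms in auto)

lemma distinct_icosahedron_points:
  assumes "p * p = p + 1"
  shows "distinct (icosahedron_points p)"
  using golden_root_neq[OF assms] by (auto simp: icosahedron_points_def)

lemma distinct_dodecahedron_points:
  assumes "p * p = p + 1"
  shows "distinct (dodecahedron_points p)"
  using golden_root_neq[OF assms] by (auto simp: dodecahedron_points_def)

text \<open>Odd moments vanish by central symmetry. The points have squared norm
  \<open>1 + p * p = p + 2\<close>, and the even moments are those of the uniform distribution on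
  their sphere, \<open>12 * (p + 2) / 3\<close> and \<open>12 * (p + 2)\<^sup>2 / 5\<close>, reduced
  by the equation for \<open>p\<close>.\<close>

lemma icosahedron_points_moments:
  fixes X Y Z p :: real
  assumes "p * p = p + 1"
  defines "Q \<equiv> X\<^sup>2 + Y\<^sup>2 + Z\<^sup>2"
  defines "m \<equiv> \<lambda>k. \<Sum>(x, y, z)\<leftarrow>icosahedron_points p. (x * X + y * Y + z * Z) ^ k"
  shows "m 1 = 0" "m 2 = 4 * (p + 2) * Q" "m 3 = 0" "m 4 = 12 * (p + 1) * Q\<^sup>2" "m 5 = 0"
proof -
  show "m 1 = 0" unfolding m_def icosahedron_points_def by simp
  show "m 2 = 4 * (p + 2) * Q" unfolding m_def icosahedron_points_def Q_def using assms(1) by simp algebra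
  show "m 3 = 0" unfolding m_def icosahedron_points_def by simp algebra
  show "m 4 = 12 * (p + 1) * Q\<^sup>2" unfolding m_def icosahedron_points_def Q_def using assms(1) by simp algebra
  show "m 5 = 0" unfolding m_def icosahedron_points_def by simp algebra
qed

text \<open>Likewise for 20 points of squared norm 3: \<open>20 * 3 / 3\<close> and
  \<open>20 * 9 / 5\<close>.\<close>

lemma dodecahedron_points_moments:
  fixes X Y Z p :: real
  assumes "p * p = p + 1"
  defines "Q \<equiv> X\<^sup>2 + Y\<^sup>2 + Z\<^sup>2"
  defines "m \<equiv> \<lambda>k. \<Sum>(x, y, z)\<leftarrow>dodecahedron_points p. (x * X + y * Y + z * Z) ^ k"
  shows "m 1 = 0" "m 2 = 20 * Q" "m 3 = 0" "m 4 = 36 * Q\<^sup>2" "m 5 = 0"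
proof -
  show "m 1 = 0" unfolding m_def dodecahedron_points_def by (simp add: algebra_simps)
  show "m 2 = 20 * Q" unfolding m_def dodecahedron_points_def Q_def using assms(1) by simp algebra
  show "m 3 = 0" unfolding m_def dodecahedron_points_def by simp algebra
  show "m 4 = 36 * Q\<^sup>2" unfolding m_def dodecahedron_points_def Q_def using assms(1) by simp algebra
  show "m 5 = 0" unfolding m_def dodecahedron_points_def by simp algebra
qed

section \<open>Generating the standard points by local moves\<close>

text \<open>\<open>T\<close> stands for \<open>face\<close> in coordinates, and \<open>p - 1\<close>
  for \<open>s\<close>. Each of the nine flips reaches one new vertex.\<close>

lemma icosahedron_points_from_flips:
  fixes T :: "real \<times> real \<times> real \<Rightarrow> real \<times> real \<times> real \<Rightarrow> real \<times> real \<times> real \<Rightarrow> bool"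
  assumes p2: "p * p = p + 1"
    and rot: "\<And>a b d. T a b d \<Longrightarrow> T b d a"
    and flip: "\<And>a b d e. T a b d \<Longrightarrow> (p - 1) *\<^sub>R (a + b) - d = e \<Longrightarrow> T a b e"
    and f0: "T (0, 1, p) (0, -1, p) (p, 0, 1)"
    and vert: "\<And>a b d. T a b d \<Longrightarrow> V d"
  shows "\<forall>q\<in>set (icosahedron_points p). V q"
proof -
  have f1: "T (0, 1, p) (0, -1, p) (-p, 0, 1)"
    by (rule flip[OF f0]) (use p2 in \<open>simp_all add: algebra_simps\<close>)
  have f2: "T (0, -1, p) (p, 0, 1) (1, -p, 0)"
    by (rule flip[OF f0[THEN rot]]) (use p2 in \<open>simp_all add: algebra_simps\<close>)
  have f3: "T (p, 0, 1) (0, 1, p) (1, p, 0)"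
    by (rule flip[OF f0[THEN rot, THEN rot]]) (use p2 in \<open>simp_all add: algebra_simps\<close>)
  have f4: "T (0, -1, p) (-p, 0, 1) (-1, -p, 0)"
    by (rule flip[OF f1[THEN rot]]) (use p2 in \<open>simp_all add: algebra_simps\<close>)
  have f5: "T (-p, 0, 1) (0, 1, p) (-1, p, 0)"
    by (rule flip[OF f1[THEN rot, THEN rot]]) (use p2 in \<open>simp_all add: algebra_simps\<close>)
  have f6: "T (p, 0, 1) (1, -p, 0) (p, 0, -1)"
    by (rule flip[OF f2[THEN rot]]) (use p2 in \<open>simp_all add: algebra_simps\<close>)
  have f7: "T (-p, 0, 1) (-1, -p, 0) (-p, 0, -1)"
    by (rule flip[OF f4[THEN rot]]) (use p2 in \<open>simp_all add: algebra_simps\<close>)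
  have f8: "T (1, -p, 0) (p, 0, -1) (0, -1, -p)"
    by (rule flip[OF f6[THEN rot]]) (use p2 in \<open>simp_all add: algebra_simps\<close>)
  have f9: "T (p, 0, -1) (0, -1, -p) (0, 1, -p)"
    by (rule flip[OF f8[THEN rot]]) (use p2 in \<open>simp_all add: algebra_simps\<close>)
  show ?thesis
    unfolding icosahedron_points_def
    using f0[THEN rot, THEN vert] f0[THEN rot, THEN rot, THEN vert] f0[THEN vert] f1[THEN vert] f2[THEN vert] f3[THEN vert] f4[THEN vert] f5[THEN vert] f6[THEN vert] f7[THEN vert] f8[THEN vert] f9[THEN vert]
    by simp
qed

text \<open>\<open>Q\<close> stands for three consecutive corners of a face. \<open>nxt\<close>
  moves on along the pentagon, \<open>third\<close> turns at the middle corner into an adjacent one.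
  Several moves reach no new point and only prepare the next turn.\<close>

lemma dodecahedron_points_from_corners:
  fixes Q :: "real \<times> real \<times> real \<Rightarrow> real \<times> real \<times> real \<Rightarrow> real \<times> real \<times> real \<Rightarrow> bool"
  assumes p2: "p * p = p + 1"
    and rev: "\<And>a b d. Q a b d \<Longrightarrow> Q d b a"
    and nxt: "\<And>a b d e. Q a b d \<Longrightarrow> a + p *\<^sub>R (d - b) = e \<Longrightarrow> Q b d e"
    and third: "\<And>a b d e. Q a b d \<Longrightarrow> (2 * p - 1) *\<^sub>R b - (a + d) = e \<Longrightarrow> Q d b e"
    and f0: "Q (0, p - 1, p) (1, 1, 1) (p - 1, p, 0)"
    and vert: "\<And>a b d. Q a b d \<Longrightarrow> V d"
  shows "\<forall>q\<in>set (dodecahedron_points p). V q"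
proof -
  have f1: "Q (1, 1, 1) (p - 1, p, 0) (1 - p, p, 0)"
    by (rule nxt[OF f0]) (use p2 in \<open>simp_all add: algebra_simps\<close>)
  have f2: "Q (p - 1, p, 0) (1, 1, 1) (p, 0, p - 1)"
    by (rule third[OF f0]) (use p2 in \<open>simp_all add: algebra_simps\<close>)
  have f3: "Q (1, 1, 1) (0, p - 1, p) (-1, 1, 1)"
    by (rule nxt[OF f0[THEN rev]]) (use p2 in \<open>simp_all add: algebra_simps\<close>)
  have f4: "Q (1 - p, p, 0) (p - 1, p, 0) (1, 1, -1)"
    by (rule third[OF f1]) (use p2 in \<open>simp_all add: algebra_simps\<close>)
  have f5: "Q (1, 1, 1) (p, 0, p - 1) (p, 0, 1 - p)"
    by (rule nxt[OF f2]) (use p2 in \<open>simp_all add: algebra_simps\<close>)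
  have f6: "Q (-1, 1, 1) (0, p - 1, p) (0, 1 - p, p)"
    by (rule third[OF f3]) (use p2 in \<open>simp_all add: algebra_simps\<close>)
  have f7: "Q (0, p - 1, p) (1, 1, 1) (p, 0, p - 1)"
    by (rule third[OF f0[THEN rev]]) (use p2 in \<open>simp_all add: algebra_simps\<close>)
  have f8: "Q (1, 1, 1) (p, 0, p - 1) (1, -1, 1)"
    by (rule nxt[OF f7]) (use p2 in \<open>simp_all add: algebra_simps\<close>)
  have f9: "Q (p - 1, p, 0) (1 - p, p, 0) (-1, 1, 1)"
    by (rule nxt[OF f1]) (use p2 in \<open>simp_all add: algebra_simps\<close>)
  have f10: "Q (-1, 1, 1) (1 - p, p, 0) (-1, 1, -1)"
    by (rule third[OF f9]) (use p2 in \<open>simp_all add: algebra_simps\<close>)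
  have f11: "Q (p - 1, p, 0) (1, 1, -1) (0, p - 1, -p)"
    by (rule nxt[OF f4]) (use p2 in \<open>simp_all add: algebra_simps\<close>)
  have f12: "Q (0, p - 1, p) (-1, 1, 1) (1 - p, p, 0)"
    by (rule nxt[OF f3]) (use p2 in \<open>simp_all add: algebra_simps\<close>)
  have f13: "Q (1 - p, p, 0) (-1, 1, 1) (-p, 0, p - 1)"
    by (rule third[OF f12]) (use p2 in \<open>simp_all add: algebra_simps\<close>)
  have f14: "Q (0, p - 1, p) (0, 1 - p, p) (-1, -1, 1)"
    by (rule nxt[OF f6]) (use p2 in \<open>simp_all add: algebra_simps\<close>)
  have f15: "Q (1 - p, p, 0) (-1, 1, -1) (-p, 0, 1 - p)"
    by (rule nxt[OF f10]) (use p2 in \<open>simp_all add: algebra_simps\<close>)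
  have f16: "Q (p, 0, p - 1) (p, 0, 1 - p) (1, 1, -1)"
    by (rule nxt[OF f5]) (use p2 in \<open>simp_all add: algebra_simps\<close>)
  have f17: "Q (1, 1, -1) (p, 0, 1 - p) (1, -1, -1)"
    by (rule third[OF f16]) (use p2 in \<open>simp_all add: algebra_simps\<close>)
  have f18: "Q (p, 0, 1 - p) (p, 0, p - 1) (1, -1, 1)"
    by (rule third[OF f5]) (use p2 in \<open>simp_all add: algebra_simps\<close>)
  have f19: "Q (p, 0, p - 1) (1, -1, 1) (p - 1, -p, 0)"
    by (rule nxt[OF f18]) (use p2 in \<open>simp_all add: algebra_simps\<close>)
  have f20: "Q (1, 1, -1) (0, p - 1, -p) (-1, 1, -1)"
    by (rule nxt[OF f11]) (use p2 in \<open>simp_all add: algebra_simps\<close>)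
  have f21: "Q (-1, 1, -1) (0, p - 1, -p) (0, 1 - p, -p)"
    by (rule third[OF f20]) (use p2 in \<open>simp_all add: algebra_simps\<close>)
  have f22: "Q (0, 1 - p, p) (-1, -1, 1) (-p, 0, p - 1)"
    by (rule nxt[OF f14]) (use p2 in \<open>simp_all add: algebra_simps\<close>)
  have f23: "Q (-p, 0, p - 1) (-1, -1, 1) (1 - p, -p, 0)"
    by (rule third[OF f22]) (use p2 in \<open>simp_all add: algebra_simps\<close>)
  have f24: "Q (-1, 1, -1) (-p, 0, 1 - p) (-p, 0, p - 1)"
    by (rule nxt[OF f15]) (use p2 in \<open>simp_all add: algebra_simps\<close>)
  have f25: "Q (-p, 0, p - 1) (-p, 0, 1 - p) (-1, -1, -1)"
    by (rule third[OF f24]) (use p2 in \<open>simp_all add: algebra_simps\<close>)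
  show ?thesis
    unfolding dodecahedron_points_def
    using f0[THEN rev, THEN vert] f1[THEN rev, THEN vert] f0[THEN vert] f1[THEN vert] f2[THEN vert] f3[THEN vert] f4[THEN vert] f5[THEN vert] f6[THEN vert] f8[THEN vert] f10[THEN vert] f11[THEN vert] f13[THEN vert] f14[THEN vert] f15[THEN vert] f17[THEN vert] f19[THEN vert] f21[THEN vert] f23[THEN vert] f25[THEN vert]
    by simp
qed


section \<open>Orthogonal frames and power means\<close>

definition combine :: "'a::real_vector \<Rightarrow> 'a \<Rightarrow> 'a \<Rightarrow> real \<times> real \<times> real \<Rightarrow> 'a" where
  "combine e1 e2 e3 = (\<lambda>(x, y, z). x *\<^sub>R e1 + y *\<^sub>R e2 + z *\<^sub>R e3)"

lemma combine_linear:
  "combine e1 e2 e3 (q + q') = combine e1 e2 e3 q + combine e1 e2 e3 q'"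
  "combine e1 e2 e3 (q - q') = combine e1 e2 e3 q - combine e1 e2 e3 q'"
  "combine e1 e2 e3 (k *\<^sub>R q) = k *\<^sub>R combine e1 e2 e3 q"
  by (auto simp: combine_def split_beta algebra_simps)

lemma inj_combine:
  fixes e1 :: "'a::real_inner"
  assumes "e1 \<bullet> e2 = 0" "e1 \<bullet> e3 = 0" "e2 \<bullet> e3 = 0"
    and "e1 \<bullet> e1 = K" "e2 \<bullet> e2 = K" "e3 \<bullet> e3 = K" "K \<noteq> 0"
  shows "inj (combine e1 e2 e3)"
proof (rule injI)
  fix q q' assume eq: "combine e1 e2 e3 q = combine e1 e2 e3 q'"
  have h: "combine e1 e2 e3 q \<bullet> e1 = K * fst q" "combine e1 e2 e3 q \<bullet> e2 = K * fst (snd q)"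
    "combine e1 e2 e3 q \<bullet> e3 = K * snd (snd q)" for q
    using assms by (simp_all add: combine_def split_beta inner_add_left inner_commute[of e2 e1] inner_commute[of e3 e1] inner_commute[of e3 e2])
  have "fst q = fst q'" "fst (snd q) = fst (snd q')" "snd (snd q) = snd (snd q')"
    using h[of q] h[of q'] assms(7) unfolding eq by auto
  then show "q = q'" by (simp add: prod_eq_iff)
qed

text \<open>Here \<open>u i\<close> is the inner product of \<open>M\<close> and \<open>A i\<close>
  seen from the centre. Expanding powers of \<open>D - 2 * u i\<close>, where the odd moments drop
  out, makes every mean a polynomial in \<open>D\<close> and \<open>R\<^sup>2 * \<rho>\<close>, with
  \<open>D\<close> itself the mean of the squares.\<close>

lemma power_mean_identities:
  fixes R \<rho> :: real
  assumes n: "0 < n"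
    and d: "\<And>i. i \<in> {1..n} \<Longrightarrow> (dist M (A i))\<^sup>2 = \<rho> + R\<^sup>2 - 2 * u i"
    and m: "(\<Sum>i=1..n. u i) = 0" "(\<Sum>i=1..n. (u i)\<^sup>2) = real n * (R\<^sup>2 * \<rho> / 3)" "(\<Sum>i=1..n. u i ^ 3) = 0"
      "(\<Sum>i=1..n. u i ^ 4) = real n * (R\<^sup>2 * \<rho>)\<^sup>2 / 5" "(\<Sum>i=1..n. u i ^ 5) = 0"
  shows "S n A M 8 - (S n A M 2) ^ 4 =
           8 * R\<^sup>2 * (S n A M 2 - R\<^sup>2) *
             ((S n A M 2)\<^sup>2 + 2 / 5 * R\<^sup>2 * (S n A M 2 - R\<^sup>2)) \<and>
         S n A M 10 - (S n A M 2) ^ 5 =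
           8 * R\<^sup>2 * S n A M 2 * (S n A M 2 - R\<^sup>2) *
             (5 / 3 * (S n A M 2)\<^sup>2 + 2 * R\<^sup>2 * (S n A M 2 - R\<^sup>2)) \<and>
         S n A M 8 =
           1 / 5 * (9 * (S n A M 4)\<^sup>2 + 12 * S n A M 4 * (S n A M 2)\<^sup>2 - 16 * (S n A M 2) ^ 4) \<and>
         S n A M 10 = S n A M 2 * S n A M 4 * (9 * S n A M 4 - 8 * (S n A M 2)\<^sup>2)"
proof -
  define D where "D = \<rho> + R\<^sup>2"
  have d': "dist M (A i) ^ (2 * k) = (D - 2 * u i) ^ k" if "i \<in> {1..n}" for i k
    using d[OF that] by (simp add: power_mult D_def)
  have Sk: "S n A M (2 * k) = (1 / real n) * (\<Sum>i=1..n. (D - 2 * u i) ^ k)" for k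
    unfolding S_def using d' by simp
  have e: "(D - 2 * x) ^ 2 = D ^ 2 - 4 * D * x + 4 * x ^ 2"
    "(D - 2 * x) ^ 4 = D ^ 4 - 8 * D ^ 3 * x + 24 * D ^ 2 * x ^ 2 - 32 * D * x ^ 3 + 16 * x ^ 4"
    "(D - 2 * x) ^ 5 = D ^ 5 - 10 * D ^ 4 * x + 40 * D ^ 3 * x ^ 2 - 80 * D ^ 2 * x ^ 3 + 80 * D * x ^ 4 - 32 * x ^ 5" for x
    by algebra+
  note lin = e sum_subtractf sum.distrib sum_distrib_left[symmetric] sum_constant m
  have s2: "S n A M 2 = D"
    using Sk[of 1, unfolded power_one_right lin] n by simp
  have s4: "S n A M 4 = D ^ 2 + 4 / 3 * (R\<^sup>2 * \<rho>)"
  proof -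
    have "real n * S n A M 4 = real n * (D ^ 2 + 4 / 3 * (R\<^sup>2 * \<rho>))"
      using Sk[of 2, unfolded lin] n by (simp add: field_simps)
    then show ?thesis using n by simp
  qed
  have s8: "S n A M 8 = D ^ 4 + 8 * D ^ 2 * (R\<^sup>2 * \<rho>) + 16 / 5 * (R\<^sup>2 * \<rho>) ^ 2"
  proof -
    have "real n * S n A M 8 = real n * (D ^ 4 + 8 * D ^ 2 * (R\<^sup>2 * \<rho>) + 16 / 5 * (R\<^sup>2 * \<rho>) ^ 2)"
      using Sk[of 4, unfolded lin] n by (simp add: field_simps)
    then show ?thesis using n by simp
  qed
  have s10: "S n A M 10 = D ^ 5 + 40 / 3 * D ^ 3 * (R\<^sup>2 * \<rho>) + 16 * D * (R\<^sup>2 * \<rho>) ^ 2"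
  proof -
    have "real n * S n A M 10 = real n * (D ^ 5 + 40 / 3 * D ^ 3 * (R\<^sup>2 * \<rho>) + 16 * D * (R\<^sup>2 * \<rho>) ^ 2)"
      using Sk[of 5, unfolded lin] n by (simp add: field_simps)
    then show ?thesis using n by simp
  qed
  have r: "\<rho> = D - R\<^sup>2" by (simp add: D_def)
  have i1: "D ^ 4 + 8 * D ^ 2 * (R\<^sup>2 * (D - R\<^sup>2)) + 16 / 5 * (R\<^sup>2 * (D - R\<^sup>2)) ^ 2 - D ^ 4
      = 8 * R\<^sup>2 * (D - R\<^sup>2) * (D\<^sup>2 + 2 / 5 * R\<^sup>2 * (D - R\<^sup>2))"
    by (simp add: power2_eq_square field_simps)
  have i2: "D ^ 5 + 40 / 3 * D ^ 3 * (R\<^sup>2 * (D - R\<^sup>2)) + 16 * D * (R\<^sup>2 * (D - R\<^sup>2)) ^ 2 - D ^ 5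
      = 8 * R\<^sup>2 * D * (D - R\<^sup>2) * (5 / 3 * D\<^sup>2 + 2 * R\<^sup>2 * (D - R\<^sup>2))"
    by (simp add: power2_eq_square power3_eq_cube field_simps)
  \<comment> \<open>The last two identities eliminate \<open>R\<^sup>2 * \<rho>\<close> through the
    fourth-power mean, so they hold for arbitrary \<open>w\<close>; the first two use
    \<open>\<rho> = D - R\<^sup>2\<close> instead.\<close>
  have i3: "D ^ 4 + 8 * D ^ 2 * w + 16 / 5 * w ^ 2
      = 1 / 5 * (9 * (D ^ 2 + 4 / 3 * w)\<^sup>2 + 12 * (D ^ 2 + 4 / 3 * w) * D\<^sup>2 - 16 * D ^ 4)" for w
    by (simp add: power2_eq_square power4_eq_xxxx field_simps)
  have i4: "D ^ 5 + 40 / 3 * D ^ 3 * w + 16 * D * w ^ 2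
      = D * (D ^ 2 + 4 / 3 * w) * (9 * (D ^ 2 + 4 / 3 * w) - 8 * D\<^sup>2)" for w
    by (simp add: power2_eq_square power3_eq_cube power_numeral_reduce field_simps)
  show ?thesis
    unfolding s2 s4 s8 s10 r using i1 i2 i3 i4 by blast
qed

lemma image_eq_vertices:
  fixes c :: "'a::real_vector"
  assumes "distinct L" "inj g" "\<forall>q\<in>set L. c + g q \<in> W" "card W = length L" "L \<noteq> []"
  shows "(\<lambda>q. c + g q) ` set L = W"
proof (rule card_subset_eq)
  show "finite W" using assms(4,5) by (intro card_ge_0_finite) simp
  have "inj_on (\<lambda>q. c + g q) (set L)" using assms(2) by (auto simp: inj_on_def)
  then show "card ((\<lambda>q. c + g q) ` set L) = card W"
    using card_image distinct_card[OF assms(1)] assms(4) by metis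
  show "(\<lambda>q. c + g q) ` set L \<subseteq> W" using assms(3) by blast
qed

text \<open>\<open>R\<^sup>2 / K\<close> is the squared norm of the coordinate triples. Hypothesis
  \<open>m\<close> is the 5-design property, tested on linear forms: 1/3 and 1/5 are the means of
  the square and the fourth power of a coordinate on the unit sphere.\<close>

lemma identities_from_coordinates:
  assumes A: "bij_betw A {1..n} W" and W: "(\<lambda>q. c + combine e1 e2 e3 q) ` set L = W"
    and L: "distinct L" "length L = n" "0 < n"
    and e: "e1 \<bullet> e2 = 0" "e1 \<bullet> e3 = 0" "e2 \<bullet> e3 = 0"
      "e1 \<bullet> e1 = K" "e2 \<bullet> e2 = K" "e3 \<bullet> e3 = K" "0 < K"
    and R: "\<And>v. v \<in> W \<Longrightarrow> dist c v = R"
    and m: "\<And>X Y Z :: real. let m = (\<lambda>k. \<Sum>(x, y, z)\<leftarrow>L. (x * X + y * Y + z * Z) ^ k); Q = X\<^sup>2 + Y\<^sup>2 + Z\<^sup>2 in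
       m 1 = 0 \<and> m 2 = real n * (R\<^sup>2 / K) / 3 * Q \<and> m 3 = 0 \<and> m 4 = real n * (R\<^sup>2 / K)\<^sup>2 / 5 * Q\<^sup>2 \<and> m 5 = 0"
  shows "S n A M 8 - (S n A M 2) ^ 4 =
           8 * R\<^sup>2 * (S n A M 2 - R\<^sup>2) *
             ((S n A M 2)\<^sup>2 + 2 / 5 * R\<^sup>2 * (S n A M 2 - R\<^sup>2)) \<and>
         S n A M 10 - (S n A M 2) ^ 5 =
           8 * R\<^sup>2 * S n A M 2 * (S n A M 2 - R\<^sup>2) *
             (5 / 3 * (S n A M 2)\<^sup>2 + 2 * R\<^sup>2 * (S n A M 2 - R\<^sup>2)) \<and>
         S n A M 8 =
           1 / 5 * (9 * (S n A M 4)\<^sup>2 + 12 * S n A M 4 * (S n A M 2)\<^sup>2 - 16 * (S n A M 2) ^ 4) \<and>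
         S n A M 10 = S n A M 2 * S n A M 4 * (9 * S n A M 4 - 8 * (S n A M 2)\<^sup>2)"
proof -
  define N where "N = M - c"
  define X Y Z where "X = N \<bullet> e1" and "Y = N \<bullet> e2" and "Z = N \<bullet> e3"
  define \<rho> where "\<rho> = N \<bullet> N"
  define u where "u i = N \<bullet> (A i - c)" for i
  have Q: "X\<^sup>2 + Y\<^sup>2 + Z\<^sup>2 = K * \<rho>"
    unfolding X_def Y_def Z_def \<rho>_def using orthogonal_triple_parseval[of e1 e2 e3 K N] e by simp
  have inj: "inj_on (\<lambda>q. c + combine e1 e2 e3 q) (set L)"
    using inj_combine[of e1 e2 e3 K] e by (auto simp: inj_on_def)
  have mom: "(\<Sum>i=1..n. u i ^ k) = (\<Sum>(x, y, z)\<leftarrow>L. (x * X + y * Y + z * Z) ^ k)" for k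
  proof -
    have "(\<Sum>i=1..n. u i ^ k) = (\<Sum>v\<in>W. (N \<bullet> (v - c)) ^ k)"
      unfolding u_def by (rule sum.reindex_bij_betw[OF A])
    also have "\<dots> = (\<Sum>q\<in>set L. (N \<bullet> combine e1 e2 e3 q) ^ k)"
      unfolding W[symmetric] by (simp add: sum.reindex[OF inj])
    also have "\<dots> = (\<Sum>q\<leftarrow>L. (N \<bullet> combine e1 e2 e3 q) ^ k)"
      using L(1) by (simp add: sum_list_distinct_conv_sum_set)
    also have "(\<lambda>q. (N \<bullet> combine e1 e2 e3 q) ^ k) = (\<lambda>(x, y, z). (x * X + y * Y + z * Z) ^ k)"
      by (auto simp: combine_def X_def Y_def Z_def inner_add_right)
    finally show ?thesis .
  qed
  note m' = m[of X Y Z, unfolded Let_def mom[symmetric] Q]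
  have d: "(dist M (A i))\<^sup>2 = \<rho> + R\<^sup>2 - 2 * u i" if i: "i \<in> {1..n}" for i
  proof -
    have "A i \<in> W" using A i by (auto simp: bij_betw_def)
    then have "dist c (A i) = R" by (rule R)
    then have "(A i - c) \<bullet> (A i - c) = R\<^sup>2"
      by (simp add: dist_norm norm_minus_commute power2_norm_eq_inner[symmetric])
    moreover have "(dist M (A i))\<^sup>2 = (N - (A i - c)) \<bullet> (N - (A i - c))"
      by (simp add: dist_norm N_def power2_norm_eq_inner)
    ultimately show ?thesis
      unfolding u_def \<rho>_def
      by (simp only: inner_diff_left[of N] inner_diff_right[of _ N] inner_commute[of "A i - c" N])
  qed
  have "(\<Sum>i=1..n. u i) = 0" "(\<Sum>i=1..n. (u i)\<^sup>2) = real n * (R\<^sup>2 * \<rho> / 3)" "(\<Sum>i=1..n. u i ^ 3) = 0"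
    "(\<Sum>i=1..n. u i ^ 4) = real n * (R\<^sup>2 * \<rho>)\<^sup>2 / 5" "(\<Sum>i=1..n. u i ^ 5) = 0"
    using m' e(7) by (simp_all add: power_mult_distrib power_divide)
  from power_mean_identities[OF L(3) d this] show ?thesis .
qed

section \<open>Coordinates for an inscribed icosahedron\<close>

text \<open>With \<open>r\<close> for \<open>R\<^sup>2\<close>. As \<open>s * (1 + s) = 1\<close>,
  multiplying the first hypothesis by \<open>1 + s\<close> solves it for \<open>r\<close>. The
  conclusions provide the length of \<open>e3\<close>, the relation between \<open>R\<close> and
  \<open>K\<close>, and the length of \<open>e1\<close>.\<close>

lemma icosahedron_gram_relations:
  fixes s t r :: real
  assumes "s * (r + t) = 2 * t" "s * s + s = 1"
  shows "s * s * (r + t) = r - t" "(r - t) * (3 + s) = 2 * r"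
    "s * s * (2 * r - 4 * s * t + s * s * (r + t)) = r - t"
proof -
  have "(s * s + s) * (r + t) = (1 + s) * (2 * t)"
    unfolding assms(1)[symmetric] by (simp add: algebra_simps)
  then have "r + t = (1 + s) * (2 * t)"
    unfolding assms(2) by simp
  then have r: "r = t * (1 + 2 * s)"
    by (simp add: algebra_simps)
  show "s * s * (r + t) = r - t" "(r - t) * (3 + s) = 2 * r"
    "s * s * (2 * r - 4 * s * t + s * s * (r + t)) = r - t"
    using assms(2) unfolding r by algebra+
qed

context inscribed_icosahedron
begin

lemma obtain_face:
  assumes "vertices P \<noteq> {}"
  obtains a b d where "face a b d"
proof -
  obtain v where v: "v \<in> vertices P" using assms by blast
  have "{F. F facet_of P \<and> v \<in> F} \<noteq> {}"
    using five[OF v] by (metis card.empty zero_neq_numeral)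
  then obtain F where F: "F facet_of P" "v \<in> F" by blast
  show ?thesis
  proof (rule facet_at_vertex[OF F(1), of "v - c"])
    show "c + (v - c) \<in> vertices P" "c + (v - c) \<in> F" using v F(2) by simp_all
  qed (rule that)
qed

lemma coordinates:
  assumes "card (vertices P) = 12"
  obtains p e1 e2 e3 K where "p * p = p + 1"
    "e1 \<bullet> e2 = 0" "e1 \<bullet> e3 = 0" "e2 \<bullet> e3 = 0" "e1 \<bullet> e1 = K" "e2 \<bullet> e2 = K" "e3 \<bullet> e3 = K" "0 < K"
    "R\<^sup>2 = K * (p + 2)" "(\<lambda>q. c + combine e1 e2 e3 q) ` set (icosahedron_points p) = vertices P"
proof -
  have "vertices P \<noteq> {}" using assms by (metis card.empty zero_neq_numeral)
  then obtain v x0 x1 where f: "face v x0 x1" by (rule obtain_face)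
  have s: "s * s + s = 1" by (rule s_eq[OF f])
  define p where "p = 1 + s"
  have p2: "p * p = p + 1" and sp: "s = p - 1" "s * p = 1"
    using s by (simp_all add: p_def algebra_simps)
  have i: "v \<bullet> v = R\<^sup>2" "x0 \<bullet> x0 = R\<^sup>2" "x1 \<bullet> x1 = R\<^sup>2" "v \<bullet> x0 = t" "x0 \<bullet> x1 = t" "x1 \<bullet> v = t"
    "x0 \<bullet> v = t" "x1 \<bullet> x0 = t" "v \<bullet> x1 = t"
    using f face_rotate face_inner face_inner_self by (metis inner_commute)+
  have tb: "t < R\<^sup>2" "- R\<^sup>2 < t" using t_bounds[OF f] by auto
  have st: "s * (R\<^sup>2 + t) = 2 * t" using tb by (simp add: s_def)
  then have st': "s * (2 * R\<^sup>2 + 2 * t) = 4 * t" by (simp add: algebra_simps)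
  define K where "K = (R\<^sup>2 - t) / 2"
  have s2: "s * s * (R\<^sup>2 + t) = R\<^sup>2 - t"
    using icosahedron_gram_relations(1)[OF st s] .
  \<comment> \<open>Solved from \<open>v = (0, 1, p)\<close>, \<open>x0 = (0, -1, p)\<close> and
    \<open>x1 = (p, 0, 1)\<close> in the frame, with \<open>1 / p = s\<close>; \<open>K\<close> is
    the squared length of \<open>e2\<close>.\<close>
  define e1 e2 e3 where "e1 = s *\<^sub>R (x1 - (s / 2) *\<^sub>R (v + x0))"
    and "e2 = (1 / 2) *\<^sub>R (v - x0)" and "e3 = (s / 2) *\<^sub>R (v + x0)"
  have w: "(v + x0) \<bullet> (v + x0) = 2 * (R\<^sup>2 + t)" "x1 \<bullet> (v + x0) = 2 * t" "(v - x0) \<bullet> (v + x0) = 0"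
    "(v - x0) \<bullet> (v - x0) = 2 * (R\<^sup>2 - t)" "x1 \<bullet> (v - x0) = 0"
    by (simp_all add: inner_add_left inner_add_right inner_diff_left inner_diff_right i)
  note w = w w(2)[unfolded inner_commute[of x1]] w(3)[unfolded inner_commute[of "v - x0"]]
  have o: "e1 \<bullet> e2 = 0" "e1 \<bullet> e3 = 0" "e2 \<bullet> e3 = 0" "e2 \<bullet> e2 = K"
    by (simp_all add: e1_def e2_def e3_def K_def inner_diff_left[of x1] w st')
  have o': "e3 \<bullet> e3 = K"
  proof -
    have "e3 \<bullet> e3 = s / 2 * (s / 2 * (2 * (R\<^sup>2 + t)))"
      unfolding e3_def inner_scaleR_left inner_scaleR_right w ..
    also have "\<dots> = s * s * (R\<^sup>2 + t) / 2" by simp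
    finally show ?thesis unfolding s2 K_def .
  qed
  have x1e: "x1 - (s / 2) *\<^sub>R (v + x0) = p *\<^sub>R e1"
    by (simp only: e1_def scaleR_scaleR mult.commute[of p s] sp(2) scaleR_one)
  have K: "0 < K" using tb by (simp add: K_def)
  have RK: "R\<^sup>2 = K * (p + 2)"
    using icosahedron_gram_relations(2)[OF st s] by (simp add: K_def p_def add.commute)
  have "e1 \<bullet> e1 = s * s * (R\<^sup>2 - 2 * s * t + s * s * (R\<^sup>2 + t) / 2)"
  proof -
    have "e1 \<bullet> e1 = s * (s * (x1 \<bullet> x1 - s / 2 * (x1 \<bullet> (v + x0)) - s / 2 * ((v + x0) \<bullet> x1 - s / 2 * ((v + x0) \<bullet> (v + x0)))))"
      by (simp only: e1_def inner_diff_left[of x1] inner_diff_right[of _ x1] inner_scaleR_left inner_scaleR_right) (simp add: algebra_simps)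
    then show ?thesis unfolding w i by (simp add: algebra_simps)
  qed
  also have "\<dots> = s * s * (2 * R\<^sup>2 - 4 * s * t + s * s * (R\<^sup>2 + t)) / 2"
    by (simp add: field_simps)
  also have "s * s * (2 * R\<^sup>2 - 4 * s * t + s * s * (R\<^sup>2 + t)) = R\<^sup>2 - t"
    by (rule icosahedron_gram_relations(3)[OF st s])
  finally have "e1 \<bullet> e1 = K"
    by (simp add: K_def)
  note o = o o' this
  let ?g = "combine e1 e2 e3"
  have g: "?g (0, 1, p) = v" "?g (0, -1, p) = x0" "?g (p, 0, 1) = x1"
  proof -
    have pe: "p *\<^sub>R e3 = (1 / 2) *\<^sub>R (v + x0)"
    proof -
      have "p * (s / 2) = 1 / 2" using sp(2) by (simp add: mult.commute)
      then show ?thesis by (simp only: e3_def scaleR_scaleR)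
    qed
    have "(1 / 2) *\<^sub>R (v - x0) + (1 / 2) *\<^sub>R (v + x0) = (1 / 2) *\<^sub>R (v + v)"
      by (simp add: algebra_simps)
    then show "?g (0, 1, p) = v"
      by (simp only: scaleR_half_double) (simp add: combine_def pe e2_def)
    have "- ((1 / 2) *\<^sub>R (v - x0)) + (1 / 2) *\<^sub>R (v + x0) = (1 / 2) *\<^sub>R (x0 + x0)"
      by (simp add: algebra_simps)
    then show "?g (0, -1, p) = x0"
      by (simp only: scaleR_half_double) (simp add: combine_def pe e2_def)
    show "?g (p, 0, 1) = x1"
      by (simp add: combine_def x1e[symmetric] e3_def)
  qed
  have all: "\<forall>q\<in>set (icosahedron_points p). c + ?g q \<in> vertices P"
  proof (rule icosahedron_points_from_flips[OF p2, where T = "\<lambda>a b d. face (?g a) (?g b) (?g d)"])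
    show "face (?g a) (?g b) (?g e)" if "face (?g a) (?g b) (?g d)" "(p - 1) *\<^sub>R (a + b) - d = e" for a b d e
      using face_flip[OF that(1)] unfolding that(2)[symmetric] by (simp add: combine_linear sp(1))
    show "c + ?g d \<in> vertices P" if "face (?g a) (?g b) (?g d)" for a b d
      using face_vertex[OF face_rotate[OF face_rotate[OF that]]] .
    show "face (?g (0, 1, p)) (?g (0, -1, p)) (?g (p, 0, 1))"
      unfolding g by (rule f)
  qed (rule face_rotate)
  have inj: "inj ?g" using inj_combine[of e1 e2 e3 K] o K by simp
  have "(\<lambda>q. c + ?g q) ` set (icosahedron_points p) = vertices P"
    by (rule image_eq_vertices[OF distinct_icosahedron_points[OF p2] inj all])
      (simp_all only: assms, simp_all add: icosahedron_points_def)
  then show ?thesis by (rule that[OF p2 o(1,2,3,6,4,5) K RK])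
qed

end

section \<open>Pentagons around a vertex\<close>

locale inscribed_dodecahedron = inscribed_polyhedron +
  fixes l :: real
  assumes facets: "\<And>F. F facet_of P \<Longrightarrow> \<exists>A B C D E. F = convex hull {A, B, C, D, E} \<and>
        vertices F = {A, B, C, D, E} \<and> pentagon l A B C D E"
    and three: "\<And>v. v \<in> vertices P \<Longrightarrow> card {F. F facet_of P \<and> v \<in> F} = 3"
begin

text \<open>Three consecutive corners determine the pentagon: by the trapezium rule
  \<open>far1\<close> follows \<open>d\<close> and \<open>far2\<close> precedes
  \<open>a\<close>.\<close>

abbreviation (input) far1 where "far1 a b d \<equiv> c + (a + golden *\<^sub>R (d - b))"
abbreviation (input) far2 where "far2 a b d \<equiv> c + (d + golden *\<^sub>R (a - b))"

definition corners :: "real^3 \<Rightarrow> real^3 \<Rightarrow> real^3 \<Rightarrow> (real^3) set" where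
  "corners a b d = {c + a, c + b, c + d, far1 a b d, far2 a b d}"

definition path :: "real^3 \<Rightarrow> real^3 \<Rightarrow> real^3 \<Rightarrow> bool" where
  "path a b d \<longleftrightarrow> pentagon l (c + a) (c + b) (c + d) (far1 a b d) (far2 a b d) \<and>
     convex hull corners a b d facet_of P \<and> vertices (convex hull corners a b d) = corners a b d"

text \<open>Since \<open>D\<close> and \<open>E\<close> are forced, any labelling of a facet as a
  pentagon yields the same corner set; reversal and rotation of paths rest on this.\<close>

lemma pathI:
  assumes p: "pentagon l (c + a) (c + b) (c + d) D E" and W: "{c + a, c + b, c + d, D, E} = W"
    and F: "convex hull W facet_of P" "vertices (convex hull W) = W"
  shows "path a b d" "corners a b d = W"
proof -
  have tr: "trapezium (c + a) (c + b) (c + d) D" "trapezium E (c + a) (c + b) (c + d)"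
    using p by (simp_all add: pentagon_def)
  have "E = (c + d) - golden *\<^sub>R ((c + b) - (c + a))"
    using tr(2) unfolding trapezium_def by (metis add_diff_cancel_right')
  then have DE: "D = far1 a b d" "E = far2 a b d"
    using tr(1) unfolding trapezium_def by (simp_all add: algebra_simps)
  then show W': "corners a b d = W" using W by (simp add: corners_def)
  show "path a b d" unfolding path_def W' using p F DE by simp
qed

lemma path_pentagon: "path a b d \<Longrightarrow> pentagon l (c + a) (c + b) (c + d) (far1 a b d) (far2 a b d)"
  and path_facet: "path a b d \<Longrightarrow> convex hull corners a b d facet_of P"
  and path_vertices: "path a b d \<Longrightarrow> vertices (convex hull corners a b d) = corners a b d"
  by (simp_all add: path_def)

lemma path_rev: assumes "path a b d" shows "path d b a"
proof (rule pathI(1)[OF _ _ path_facet[OF assms] path_vertices[OF assms]])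
  show "pentagon l (c + d) (c + b) (c + a) (far2 a b d) (far1 a b d)"
    by (rule pentagon_rotate[OF pentagon_rotate[OF pentagon_flip[OF path_pentagon[OF assms]]]])
  show "{c + d, c + b, c + a, far2 a b d, far1 a b d} = corners a b d"
    by (auto simp: corners_def)
qed

lemma path_next: assumes "path a b d" shows "path b d (a + golden *\<^sub>R (d - b))"
proof (rule pathI(1)[OF _ _ path_facet[OF assms] path_vertices[OF assms]])
  show "pentagon l (c + b) (c + d) (far1 a b d) (far2 a b d) (c + a)"
    by (rule pentagon_rotate[OF path_pentagon[OF assms]])
  show "{c + b, c + d, far1 a b d, far2 a b d, c + a} = corners a b d"
    by (auto simp: corners_def)
qed

lemma path_vertex: assumes "path a b d" shows "c + a \<in> vertices P" "c + b \<in> vertices P" "c + d \<in> vertices P"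
  using vertices_facet[OF path_facet[OF assms]] path_vertices[OF assms] by (auto simp: corners_def)

lemma path_dist: assumes "path a b d" shows "0 < l" "dist a b = l" "dist b d = l" "dist a d = golden * l"
  using path_pentagon[OF assms] by (simp_all add: pentagon_def)

lemma path_inner_self: "path a b d \<Longrightarrow> a \<bullet> a = R\<^sup>2" "path a b d \<Longrightarrow> b \<bullet> b = R\<^sup>2"
  using on_sphere[OF path_vertex(1)] on_sphere[OF path_vertex(2)]
  by (simp_all add: dist_norm power2_norm_eq_inner[symmetric])

lemma path_inner:
  assumes "path a b d"
  shows "a \<bullet> b = R\<^sup>2 - l\<^sup>2 / 2" "a \<bullet> d = R\<^sup>2 - (golden + 1) * l\<^sup>2 / 2"
proof -
  have i: "a \<bullet> a = R\<^sup>2" "b \<bullet> b = R\<^sup>2" "d \<bullet> d = R\<^sup>2"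
    using path_inner_self assms path_rev by blast+
  have "(a - b) \<bullet> (a - b) = l\<^sup>2" "(a - d) \<bullet> (a - d) = (golden * l)\<^sup>2"
    using path_dist[OF assms] by (simp_all add: dist_norm power2_norm_eq_inner[symmetric])
  moreover have "(golden * l)\<^sup>2 = (golden + 1) * l\<^sup>2"
    using golden_sq by (simp add: power2_eq_square)
  ultimately have "2 * (a \<bullet> b) = 2 * R\<^sup>2 - l\<^sup>2" "2 * (a \<bullet> d) = 2 * R\<^sup>2 - (golden + 1) * l\<^sup>2"
    by (simp_all add: inner_diff_left inner_diff_right i inner_commute[of b a] inner_commute[of d a])
  then show "a \<bullet> b = R\<^sup>2 - l\<^sup>2 / 2" "a \<bullet> d = R\<^sup>2 - (golden + 1) * l\<^sup>2 / 2"
    by simp_all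
qed

lemma facet_at_vertex:
  assumes F: "F facet_of P" and b: "c + b \<in> vertices P" "c + b \<in> F"
  obtains a d where "path a b d" "F = convex hull corners a b d"
proof -
  obtain A B C D E where p: "F = convex hull {A, B, C, D, E}" "vertices F = {A, B, C, D, E}"
    "pentagon l A B C D E"
    using facets[OF F] by blast
  have "c + b \<in> {A, B, C, D, E}"
    using b vertices_facet[OF F] p by auto
  then obtain y C' D' E' where y: "pentagon l y (c + b) C' D' E'" "{y, c + b, C', D', E'} = {A, B, C, D, E}"
    using pentagon_corner[OF p(3)] by blast
  have y': "c + (y - c) = y" "c + (C' - c) = C'" by simp_all
  note pth = pathI[of "y - c" b "C' - c", unfolded y', OF y F[unfolded p(1)] p(2)[unfolded p(1)]]
  show ?thesis using that[OF pth(1)] pth(2) p(1) by simp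
qed

text \<open>Seen from \<open>b\<close>, the corners off the edge are \<open>Y\<close>,
  \<open>X + golden *\<^sub>R Y\<close> and \<open>Y + golden *\<^sub>R X\<close>. All have positive
  inner product with the inward normal of the edge \<open>X\<close>, which is orthogonal to
  \<open>X\<close> and positive on \<open>Y\<close>.\<close>

lemma path_across_edge:
  assumes f: "path a b d"
  obtains d' where "d' \<noteq> d" "path a b d'"
proof -
  note l = path_dist[OF f]
  define X Y where "X = a - b" and "Y = d - b"
  have "\<bar>X \<bullet> Y\<bar> < norm X * norm Y"
  proof -
    have n: "norm X = l" "norm Y = l" "norm (X - Y) = golden * l"
      using l by (simp_all add: X_def Y_def dist_norm norm_minus_commute)
    have "(X - Y) \<bullet> (X - Y) = (golden * l)\<^sup>2"
      using n(3) by (simp add: power2_norm_eq_inner[symmetric])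
    also have "(golden * l)\<^sup>2 = (golden + 1) * l\<^sup>2"
      using golden_sq by (simp add: power2_eq_square)
    finally have "X \<bullet> X - 2 * (X \<bullet> Y) + Y \<bullet> Y = (golden + 1) * l\<^sup>2"
      by (simp add: inner_diff_left inner_diff_right inner_commute[of Y X])
    moreover have "X \<bullet> X = l\<^sup>2" "Y \<bullet> Y = l\<^sup>2"
      using n by (simp_all add: power2_norm_eq_inner[symmetric])
    ultimately have xy: "X \<bullet> Y = - ((golden - 1) / 2) * l\<^sup>2"
      by (simp add: field_simps)
    have "(golden - 1) / 2 * l\<^sup>2 < 1 * l\<^sup>2"
      using l(1) golden_bounds by (intro mult_strict_right_mono) simp_all
    moreover have "0 \<le> (golden - 1) / 2 * l\<^sup>2"
      using golden_bounds by simp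
    ultimately show ?thesis unfolding xy n by (simp add: power2_eq_square)
  qed
  note n = inner_orthogonal_part_pos[OF this]
  let ?n = "(X \<bullet> X) *\<^sub>R Y - (X \<bullet> Y) *\<^sub>R X"
  have "convex hull {c + b, c + a} face_of convex hull corners a b d"
  proof (rule segment_face_of_hull)
    show "?n \<bullet> ((c + a) - (c + b)) = 0" using n(1) by (simp add: X_def)
    have "z - (c + b) \<in> {Y, X + golden *\<^sub>R Y, Y + golden *\<^sub>R X}"
      if "z \<in> corners a b d - {c + b, c + a}" for z
      using that by (auto simp: corners_def X_def Y_def)
    moreover have "0 < ?n \<bullet> w" if "w \<in> {Y, X + golden *\<^sub>R Y, Y + golden *\<^sub>R X}" for w
    proof -
      have "?n \<bullet> (X + golden *\<^sub>R Y) = golden * (?n \<bullet> Y)" "?n \<bullet> (Y + golden *\<^sub>R X) = ?n \<bullet> Y"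
        using n(1) by (simp_all only: inner_add_right[of ?n] inner_scaleR_right[of ?n])
      then show ?thesis using that n(2) golden_bounds(1) by (elim insertE emptyE) simp_all
    qed
    ultimately show "0 < ?n \<bullet> (z - (c + b))" if "z \<in> corners a b d - {c + b, c + a}" for z
      using that by blast
  qed (auto simp: corners_def)
  then obtain G where G: "G facet_of P" "G \<noteq> convex hull corners a b d" "c + b \<in> G" "c + a \<in> G"
    by (rule edge_in_second_facet[OF polytope dim path_facet[OF f]])
  obtain A B C D E where p: "G = convex hull {A, B, C, D, E}" "vertices G = {A, B, C, D, E}"
    "pentagon l A B C D E"
    using facets[OF G(1)] by blast
  have "c + a \<in> {A, B, C, D, E}" "c + b \<in> {A, B, C, D, E}"
    using G vertices_facet[OF G(1)] path_vertex[OF f] p by blast+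
  then obtain C' D' E' where y: "pentagon l (c + a) (c + b) C' D' E'" "{c + a, c + b, C', D', E'} = {A, B, C, D, E}"
    by (rule pentagon_through_edge[OF p(3)]) (use l in auto)
  have y': "c + (C' - c) = C'" by simp
  note pth = pathI[of a b "C' - c", unfolded y', OF y G(1)[unfolded p(1)] p(2)[unfolded p(1)]]
  have "C' - c \<noteq> d" using G(2) pth(2) p(1) by auto
  then show ?thesis using that pth(1) by blast
qed

text \<open>The two far corners are at diagonal distance from \<open>b\<close>. Thus the facet alone
  gives back the unordered pair \<open>a\<close>, \<open>d\<close>.\<close>

lemma neighbours_in_facet:
  assumes f: "path a b d"
  shows "{x. c + x \<in> vertices (convex hull corners a b d) \<and> dist x b = l} = {a, d}"
proof -
  have l: "l > 0" "golden * l \<noteq> l" using path_dist(1)[OF f] golden_bounds by auto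
  have "dist (a + golden *\<^sub>R (d - b)) b = golden * l" "dist (d + golden *\<^sub>R (a - b)) b = golden * l"
    using path_pentagon[OF f] by (simp_all add: pentagon_def dist_commute)
  then show ?thesis
    using l path_dist[OF f] golden_bounds unfolding path_vertices[OF f]
    by (auto simp: corners_def dist_commute)
qed

lemma card_link:
  assumes "path a b d"
  shows "card {{x, y} | x y. path x b y} = 3"
proof -
  let ?\<F> = "{F. F facet_of P \<and> c + b \<in> F}"
  let ?h = "\<lambda>F. {x. c + x \<in> vertices F \<and> dist x b = l}"
  have F: "\<exists>x y. path x b y \<and> F = convex hull corners x b y \<and> ?h F = {x, y}" if F: "F \<in> ?\<F>" for F
  proof -
    have "F facet_of P" "c + b \<in> F" using F by simp_all
    then obtain x y where "path x b y" "F = convex hull corners x b y"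
      by (rule facet_at_vertex[OF _ path_vertex(2)[OF assms]])
    then show ?thesis using neighbours_in_facet by blast
  qed
  have "inj_on ?h ?\<F>"
  proof (rule inj_onI)
    fix F G assume FG: "F \<in> ?\<F>" "G \<in> ?\<F>" "?h F = ?h G"
    obtain x y where x: "F = convex hull corners x b y" "?h F = {x, y}" using F[OF FG(1)] by blast
    obtain x' y' where x': "G = convex hull corners x' b y'" "?h G = {x', y'}" using F[OF FG(2)] by blast
    have "{x, y} = {x', y'}" using x(2) x'(2) FG(3) by simp
    then have "corners x b y = corners x' b y'"
      by (auto simp: doubleton_eq_iff corners_def)
    then show "F = G" using x(1) x'(1) by simp
  qed
  then have "card (?h ` ?\<F>) = card ?\<F>" by (rule card_image)
  moreover have "?h ` ?\<F> = {{x, y} | x y. path x b y}"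
  proof
    show "?h ` ?\<F> \<subseteq> {{x, y} | x y. path x b y}" using F by fast
    show "{{x, y} | x y. path x b y} \<subseteq> ?h ` ?\<F>"
    proof
      fix e assume "e \<in> {{x, y} | x y. path x b y}"
      then obtain x y where e: "e = {x, y}" "path x b y" by blast
      have "convex hull corners x b y \<in> ?\<F>"
        using path_facet[OF e(2)] by (auto simp: corners_def hull_inc)
      then show "e \<in> ?h ` ?\<F>" using neighbours_in_facet[OF e(2)] e(1) by blast
    qed
  qed
  ultimately show ?thesis using three[OF path_vertex(2)[OF assms]] by (simp only:)
qed

text \<open>The link of \<open>b\<close> has three edges, one per facet, and continuation across
  edges leaves no vertex of degree one: it is a triangle.\<close>

lemma third_neighbour:
  assumes p: "path a b d"
  obtains f where "path d b f" "path f b a"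
proof -
  let ?\<E> = "{{x, y} | x y. path x b y}"
  have ne: "x \<noteq> y" if "path x b y" for x y
    using path_dist[OF that] golden_bounds by auto
  have E: "path x b y" if "{x, y} \<in> ?\<E>" for x y
    using that path_rev by (auto simp: doubleton_eq_iff)
  obtain f where "{d, f} \<in> ?\<E>" "{f, a} \<in> ?\<E>"
  proof (rule third_side[of ?\<E> a d])
    show "card ?\<E> = 3" by (rule card_link[OF p])
    show "card e = 2" if "e \<in> ?\<E>" for e
      using that ne by auto
    show "\<exists>e'\<in>?\<E>. e' \<noteq> e \<and> x \<in> e'" if e: "e \<in> ?\<E>" "x \<in> e" for e x
    proof -
      obtain y where y: "e = {x, y}" "path x b y"
        using e path_rev by (auto simp: insert_commute)
      obtain y' where "y' \<noteq> y" "path x b y'" by (rule path_across_edge[OF y(2)])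
      then show ?thesis using y ne[OF y(2)] by (intro bexI[of _ "{x, y'}"]) (auto simp: doubleton_eq_iff)
    qed
    show "{a, d} \<in> ?\<E>" using p by blast
  qed blast
  then show ?thesis using that E by blast
qed

text \<open>\<open>a\<close>, \<open>d\<close>, \<open>f\<close> have equal inner products with
  \<open>b\<close> and with each other, so their sum is orthogonal to \<open>a - d\<close> and
  \<open>a - f\<close>, hence a multiple of \<open>b\<close>. Comparing lengths then determines the
  edge length, and the factor becomes \<open>2 * golden - 1 = sqrt 5\<close>.\<close>

lemma path_third:
  assumes p: "path a b d"
  shows "path d b ((2 * golden - 1) *\<^sub>R b - (a + d))" "R\<^sup>2 - l\<^sup>2 / 2 = (2 * golden - 1) * R\<^sup>2 / 3"
    "R\<^sup>2 - (golden + 1) * l\<^sup>2 / 2 = R\<^sup>2 / 3"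
proof -
  obtain f where f: "path d b f" "path f b a" by (rule third_neighbour[OF p])
  define r L where "r = R\<^sup>2" and "L = l\<^sup>2"
  have rL: "0 < r" "0 < L" using R_pos path_dist(1)[OF p] by (simp_all add: r_def L_def)
  define t \<delta> where "t = r - L / 2" and "\<delta> = r - (golden + 1) * L / 2"
  have i: "a \<bullet> a = r" "b \<bullet> b = r" "d \<bullet> d = r" "f \<bullet> f = r" "a \<bullet> b = t" "d \<bullet> b = t" "f \<bullet> b = t"
    "a \<bullet> d = \<delta>" "d \<bullet> f = \<delta>" "f \<bullet> a = \<delta>"
    unfolding r_def L_def t_def \<delta>_def
    using path_inner_self(1)[OF p] path_inner_self(2)[OF p] path_inner_self(1)[OF f(1)] path_inner_self(1)[OF f(2)]
      path_inner[OF p] path_inner[OF f(1)] path_inner[OF f(2)] by simp_all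
  note i = i i(5-10)[unfolded inner_commute[of a b] inner_commute[of d b] inner_commute[of f b]
      inner_commute[of a d] inner_commute[of d f] inner_commute[of f a]]
  define k where "k = 3 * t / r"
  define z where "z = a + d + f - k *\<^sub>R b"
  have kr: "k * r = 3 * t" using rL by (simp add: k_def)
  have "z = 0"
  proof (rule orthogonal_gram3[of z "a - d" "a - f" b])
    show "z \<bullet> (a - d) = 0" "z \<bullet> (a - f) = 0" "z \<bullet> b = 0"
      using kr by (simp_all add: z_def inner_add_left inner_diff_left inner_diff_right i)
    have o: "(a - d) \<bullet> b = 0" "(a - f) \<bullet> b = 0" "(a - d) \<bullet> (a - d) = 2 * (r - \<delta>)"
      "(a - f) \<bullet> (a - f) = 2 * (r - \<delta>)" "(a - d) \<bullet> (a - f) = r - \<delta>"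
      by (simp_all add: inner_diff_left inner_diff_right i)
    have "r - \<delta> \<noteq> 0" using rL golden_bounds by (simp add: \<delta>_def)
    then have "3 * (r - \<delta>)\<^sup>2 * r \<noteq> 0" using rL by simp
    then show "((a - d) \<bullet> (a - d)) * ((a - f) \<bullet> (a - f)) * (b \<bullet> b) + 2 * ((a - d) \<bullet> (a - f)) * ((a - f) \<bullet> b) * ((a - d) \<bullet> b)
       - ((a - d) \<bullet> (a - d)) * ((a - f) \<bullet> b)\<^sup>2 - ((a - f) \<bullet> (a - f)) * ((a - d) \<bullet> b)\<^sup>2 - (b \<bullet> b) * ((a - d) \<bullet> (a - f))\<^sup>2 \<noteq> 0"
      unfolding o i(2) by (simp add: power2_eq_square algebra_simps)
  qed
  then have sum: "a + d + f = k *\<^sub>R b" by (simp add: z_def)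
  have "(a + d + f) \<bullet> (a + d + f) = 3 * r + 6 * \<delta>"
    by (simp add: inner_add_left inner_add_right i)
  then have kk: "k * k * r = 3 * r + 6 * \<delta>"
    unfolding sum by (simp add: i)
  \<comment> \<open>In terms of \<open>L\<close> this reads
    \<open>9 * t\<^sup>2 = r * (3 * r + 6 * \<delta>)\<close>. The terms in \<open>r\<^sup>2\<close>
    cancel, and a factor \<open>L\<close> can be divided out.\<close>
  have "(3 * t) * (3 * t) = r * (k * k * r)"
    unfolding kr[symmetric] by simp
  then have "L * (9 * L) = L * (12 * (2 - golden) * r)"
    unfolding kk by (simp add: t_def \<delta>_def field_simps)
  then have "9 * L = 12 * (2 - golden) * r"
    using rL by simp
  then have L: "L = 4 / 3 * (2 - golden) * r"
    by (simp add: algebra_simps)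
  have t: "t = (2 * golden - 1) * r / 3" by (simp add: t_def L field_simps)
  have "(golden + 1) * (2 - golden) = 1" using golden_sq by (simp add: algebra_simps)
  moreover have "(golden + 1) * L = 4 / 3 * ((golden + 1) * (2 - golden)) * r"
    unfolding L by simp
  ultimately have "(golden + 1) * L = 4 / 3 * r" by simp
  then have \<delta>: "\<delta> = r / 3" unfolding \<delta>_def by simp
  show "R\<^sup>2 - l\<^sup>2 / 2 = (2 * golden - 1) * R\<^sup>2 / 3"
    "R\<^sup>2 - (golden + 1) * l\<^sup>2 / 2 = R\<^sup>2 / 3"
    using t \<delta> unfolding t_def \<delta>_def r_def L_def by simp_all
  have k: "k = 2 * golden - 1" using rL by (simp add: k_def t)
  have "f = k *\<^sub>R b - (a + d)" using sum by (simp add: algebra_simps)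
  then have "f = (2 * golden - 1) *\<^sub>R b - (a + d)" unfolding k .
  then show "path d b ((2 * golden - 1) *\<^sub>R b - (a + d))" using f(1) by simp
qed

lemma obtain_path:
  assumes "vertices P \<noteq> {}"
  obtains a b d where "path a b d"
proof -
  obtain v where v: "v \<in> vertices P" using assms by blast
  have "{F. F facet_of P \<and> v \<in> F} \<noteq> {}"
    using three[OF v] by (metis card.empty zero_neq_numeral)
  then obtain F where F: "F facet_of P" "v \<in> F" by blast
  show ?thesis
  proof (rule facet_at_vertex[OF F(1), of "v - c"])
    show "c + (v - c) \<in> vertices P" "c + (v - c) \<in> F" using v F(2) by simp_all
  qed (rule that)
qed

lemma coordinates:
  assumes "card (vertices P) = 20"
  obtains e1 e2 e3 K where
    "e1 \<bullet> e2 = 0" "e1 \<bullet> e3 = 0" "e2 \<bullet> e3 = 0" "e1 \<bullet> e1 = K" "e2 \<bullet> e2 = K" "e3 \<bullet> e3 = K" "0 < K"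
    "R\<^sup>2 = 3 * K" "(\<lambda>q. c + combine e1 e2 e3 q) ` set (dodecahedron_points golden) = vertices P"
proof -
  have "vertices P \<noteq> {}" using assms by (metis card.empty zero_neq_numeral)
  then obtain a v b where p: "path a v b" by (rule obtain_path)
  define d where "d = (2 * golden - 1) *\<^sub>R v - (a + b)"
  have pd: "path b v d" unfolding d_def by (rule path_third(1)[OF p])
  \<comment> \<open>Turning at \<open>v\<close> once more leads back to \<open>a\<close>, which
    supplies the inner product of \<open>d\<close> and \<open>a\<close>.\<close>
  have pa: "path d v a"
    using path_third(1)[OF pd] by (simp add: d_def)
  define K where "K = R\<^sup>2 / 3"
  have K: "0 < K" and RK: "R\<^sup>2 = 3 * K" using R_pos by (simp_all add: K_def)
  have i: "a \<bullet> a = 3 * K" "b \<bullet> b = 3 * K" "d \<bullet> d = 3 * K" "a \<bullet> b = K" "b \<bullet> d = K" "d \<bullet> a = K"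
    using path_inner_self(1)[OF p] path_inner_self(1)[OF pd] path_inner_self(1)[OF pa]
      path_inner(2)[OF p] path_inner(2)[OF pd] path_inner(2)[OF pa] path_third(3)[OF p]
    by (simp_all add: K_def)
  note i = i i(4-6)[unfolded inner_commute[of a b] inner_commute[of b d] inner_commute[of d a]]
  define g where "g = golden"
  have g2: "g * g = g + 1" unfolding g_def by (rule golden_sq)
  \<comment> \<open>\<open>m\<close> is \<open>1 / (2 * sqrt 5)\<close>, the scalar factor of the
    inverse circulant; the remaining entries are integral in \<open>g\<close>. The corner
    \<open>v\<close> is to become \<open>(1, 1, 1)\<close>, and its neighbours \<open>a\<close>,
    \<open>b\<close>, \<open>d\<close> the cyclic permutations of
    \<open>(0, g - 1, g)\<close>.\<close>
  define m where "m = (2 * g - 1) / 10"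
  have m1: "10 * m = 2 * g - 1" by (simp add: m_def)
  have m2: "20 * (m * m) = 1" using m1 g2 by algebra
  have ip: "(x *\<^sub>R a + y *\<^sub>R b + z *\<^sub>R d) \<bullet> (x' *\<^sub>R a + y' *\<^sub>R b + z' *\<^sub>R d)
      = K * (3 * (x * x' + y * y' + z * z') + x * y' + x * z' + y * x' + y * z' + z * x' + z * y')" for x y z x' y' z'
    by (simp add: inner_add_left inner_add_right i algebra_simps)
  define e where "e x y z = (m * x) *\<^sub>R a + (m * y) *\<^sub>R b + (m * z) *\<^sub>R d" for x y z
  \<comment> \<open>the inverse of the circulant matrix expressing \<open>a\<close>, \<open>b\<close>, \<open>d\<close> in the frame to be found\<close>
  define e1 e2 e3 where "e1 = e (- 1) (2 - g) (g + 1)" and "e2 = e (2 - g) (g + 1) (- 1)"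
    and "e3 = e (g + 1) (- 1) (2 - g)"
  have ie: "e x y z \<bullet> e x' y' z' = w / 20 * K"
    if "3 * (x * x' + y * y' + z * z') + x * y' + x * z' + y * x' + y * z' + z * x' + z * y' = w" for x y z x' y' z' w
  proof -
    have "e x y z \<bullet> e x' y' z' = (m * m) * w * K"
      unfolding e_def ip that[symmetric] by (simp add: algebra_simps)
    also have "m * m = 1 / 20" using m2 by simp
    finally show ?thesis by simp
  qed
  have o: "e1 \<bullet> e2 = 0" "e1 \<bullet> e3 = 0" "e2 \<bullet> e3 = 0"
    unfolding e1_def e2_def e3_def by (subst ie[of _ _ _ _ _ _ 0]; (use g2 in algebra)?; simp)+
  have o': "e1 \<bullet> e1 = K" "e2 \<bullet> e2 = K" "e3 \<bullet> e3 = K"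
    unfolding e1_def e2_def e3_def by (subst ie[of _ _ _ _ _ _ 20]; (use g2 in algebra)?; simp)+
  let ?g = "combine e1 e2 e3"
  have ge: "?g (x, y, z) = e (- x + (2 - g) * y + (g + 1) * z) ((2 - g) * x + (g + 1) * y - z) ((g + 1) * x - y + (2 - g) * z)" for x y z
    by (simp add: combine_def e1_def e2_def e3_def e_def algebra_simps)
  have ex: "e x y z = x' *\<^sub>R a + y' *\<^sub>R b + z' *\<^sub>R d" if "m * x = x'" "m * y = y'" "m * z = z'" for x y z x' y' z'
    unfolding e_def that ..
  have gp: "?g (0, g - 1, g) = a" "?g (g - 1, g, 0) = b"
  proof -
    have "?g (0, g - 1, g) = 1 *\<^sub>R a + 0 *\<^sub>R b + 0 *\<^sub>R d"
      unfolding ge by (rule ex) (use m1 g2 in algebra)+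
    then show "?g (0, g - 1, g) = a" by simp
    have "?g (g - 1, g, 0) = 0 *\<^sub>R a + 1 *\<^sub>R b + 0 *\<^sub>R d"
      unfolding ge by (rule ex) (use m1 g2 in algebra)+
    then show "?g (g - 1, g, 0) = b" by simp
  qed
  have gv: "?g (1, 1, 1) = v"
  proof -
    have "?g (1, 1, 1) = (2 * m) *\<^sub>R a + (2 * m) *\<^sub>R b + (2 * m) *\<^sub>R d"
      unfolding ge by (rule ex) (simp_all add: algebra_simps)
    also have "\<dots> = (2 * m) *\<^sub>R (a + b + d)" by (simp add: algebra_simps)
    also have "a + b + d = (2 * g - 1) *\<^sub>R v" by (simp add: d_def g_def)
    also have "(2 * m) *\<^sub>R (2 * g - 1) *\<^sub>R v = (2 * m * (2 * g - 1)) *\<^sub>R v" by simp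
    also have "2 * m * (2 * g - 1) = 1" unfolding m1[symmetric] using m2 by simp
    finally show ?thesis by simp
  qed
  have all: "\<forall>q\<in>set (dodecahedron_points golden). c + ?g q \<in> vertices P"
  proof (rule dodecahedron_points_from_corners[OF golden_sq, where Q = "\<lambda>a b d. path (?g a) (?g b) (?g d)"])
    show "path (?g b) (?g d) (?g e)" if "path (?g a) (?g b) (?g d)" "a + golden *\<^sub>R (d - b) = e" for a b d e
      using path_next[OF that(1)] unfolding that(2)[symmetric] by (simp add: combine_linear)
    show "path (?g d) (?g b) (?g e)" if "path (?g a) (?g b) (?g d)" "(2 * golden - 1) *\<^sub>R b - (a + d) = e" for a b d e
      using path_third(1)[OF that(1)] unfolding that(2)[symmetric] by (simp add: combine_linear)
    show "path (?g (0, golden - 1, golden)) (?g (1, 1, 1)) (?g (golden - 1, golden, 0))"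
      using p unfolding gp[unfolded g_def] gv .
    show "path (?g d) (?g b) (?g a)" if "path (?g a) (?g b) (?g d)" for a b d
      by (rule path_rev[OF that])
    show "c + ?g d \<in> vertices P" if "path (?g a) (?g b) (?g d)" for a b d
      by (rule path_vertex(3)[OF that])
  qed
  have inj: "inj ?g" using inj_combine[of e1 e2 e3 K] o o' K by simp
  have "(\<lambda>q. c + ?g q) ` set (dodecahedron_points golden) = vertices P"
    by (rule image_eq_vertices[OF distinct_dodecahedron_points[OF golden_sq] inj all])
      (simp_all only: assms, simp_all add: dodecahedron_points_def)
  then show ?thesis by (rule that[OF o o' K RK])
qed

end

section \<open>The power mean identities\<close>

text \<open>That \<open>r\<close> is positive can only be read off an actual facet, which exists
  because the dimension is 3.\<close>

lemma inscribed_polyhedron_cases: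
  assumes "regular_polyhedron p q P" "has_circumradius P R" "0 < R"
  obtains c r where "inscribed_polyhedron P c R" "0 < r"
    "\<forall>F. F facet_of P \<longrightarrow> regular_polygon p r F"
    "\<forall>v\<in>vertices P. card {F. F facet_of P \<and> v \<in> F} = q"
proof -
  obtain c where c: "\<forall>v\<in>vertices P. dist c v = R"
    using assms(2) by (auto simp: has_circumradius_def)
  obtain r where r: "\<forall>F. F facet_of P \<longrightarrow> regular_polygon p r F"
    using assms(1) by (auto simp: regular_polyhedron_def)
  have P: "polytope P" "aff_dim P = 3" "\<forall>v\<in>vertices P. card {F. F facet_of P \<and> v \<in> F} = q"
    using assms(1) by (simp_all add: regular_polyhedron_def)
  obtain F where "F facet_of P"
    using polytope_facet_exists[OF P(1)] P(2) by auto
  then have "0 < r" using r by (auto simp: regular_polygon_def)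
  moreover have "inscribed_polyhedron P c R"
    using P c assms(3) by unfold_locales auto
  ultimately show ?thesis using that[of c r] r P(3) by blast
qed

theorem theorem7p4:
  fixes P :: "(real^3) set" and A :: "nat \<Rightarrow> real^3" and M :: "real^3"
    and n :: nat and R :: real
  assumes "(regular_icosahedron P \<and> n = 12) \<or> (regular_dodecahedron P \<and> n = 20)"
    and "bij_betw A {1..n} (vertices P)"
    and "has_circumradius P R" and "R > 0"
  shows "S n A M 8 - (S n A M 2) ^ 4 =
           8 * R\<^sup>2 * (S n A M 2 - R\<^sup>2) *
             ((S n A M 2)\<^sup>2 + 2 / 5 * R\<^sup>2 * (S n A M 2 - R\<^sup>2)) \<and>
         S n A M 10 - (S n A M 2) ^ 5 =
           8 * R\<^sup>2 * S n A M 2 * (S n A M 2 - R\<^sup>2) *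
             (5 / 3 * (S n A M 2)\<^sup>2 + 2 * R\<^sup>2 * (S n A M 2 - R\<^sup>2)) \<and>
         S n A M 8 =
           1 / 5 * (9 * (S n A M 4)\<^sup>2 + 12 * S n A M 4 * (S n A M 2)\<^sup>2 - 16 * (S n A M 2) ^ 4) \<and>
         S n A M 10 = S n A M 2 * S n A M 4 * (9 * S n A M 4 - 8 * (S n A M 2)\<^sup>2)"
proof -
  have card: "card (vertices P) = n"
    using bij_betw_same_card[OF assms(2)] by simp
  from assms(1) show ?thesis
  proof
    assume ico: "regular_icosahedron P \<and> n = 12"
    then have "regular_polyhedron 3 5 P" by (simp add: regular_icosahedron_def)
    then obtain c r where P: "inscribed_polyhedron P c R" "0 < r"
      "\<forall>F. F facet_of P \<longrightarrow> regular_polygon 3 r F"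
      "\<forall>v\<in>vertices P. card {F. F facet_of P \<and> v \<in> F} = 5"
      by (rule inscribed_polyhedron_cases[OF _ assms(3,4)])
    interpret inscribed_polyhedron P c R by (rule P(1))
    interpret inscribed_icosahedron P c R "sqrt 3 * r"
    proof
      show "\<exists>A B C. F = convex hull {A, B, C} \<and> vertices F = {A, B, C} \<and>
          dist A B = sqrt 3 * r \<and> dist B C = sqrt 3 * r \<and> dist C A = sqrt 3 * r" if "F facet_of P" for F
        using regular_triangle[OF P(3)[rule_format, OF that]] by metis
    qed (use P in auto)
    obtain p e1 e2 e3 K where p2: "p * p = p + 1"
      and e: "e1 \<bullet> e2 = 0" "e1 \<bullet> e3 = 0" "e2 \<bullet> e3 = 0" "e1 \<bullet> e1 = K" "e2 \<bullet> e2 = K" "e3 \<bullet> e3 = K" "0 < K"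
      and R: "R\<^sup>2 = K * (p + 2)"
      and V: "(\<lambda>q. c + combine e1 e2 e3 q) ` set (icosahedron_points p) = vertices P"
      using coordinates card ico by metis
    have RK: "R\<^sup>2 / K = p + 2" using R e(7) by simp
    \<comment> \<open>Matches the fourth moment \<open>12 * (p + 1)\<close> with the design value
      \<open>12 * (p + 2)\<^sup>2 / 5\<close>.\<close>
    have "(p + 2)\<^sup>2 = 5 * (p + 1)" using p2 by algebra
    then show ?thesis
      using ico icosahedron_points_moments[OF p2]
      by (intro identities_from_coordinates[OF assms(2) V distinct_icosahedron_points[OF p2] _ _ e on_sphere])
        (simp_all add: RK Let_def icosahedron_points_def)
  next
    assume dod: "regular_dodecahedron P \<and> n = 20"
    then have "regular_polyhedron 5 3 P" by (simp add: regular_dodecahedron_def)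
    then obtain c r where P: "inscribed_polyhedron P c R" "0 < r"
      "\<forall>F. F facet_of P \<longrightarrow> regular_polygon 5 r F"
      "\<forall>v\<in>vertices P. card {F. F facet_of P \<and> v \<in> F} = 3"
      by (rule inscribed_polyhedron_cases[OF _ assms(3,4)])
    interpret inscribed_polyhedron P c R by (rule P(1))
    interpret inscribed_dodecahedron P c R "sqrt (3 - golden) * r"
    proof
      show "\<exists>A B C D E. F = convex hull {A, B, C, D, E} \<and> vertices F = {A, B, C, D, E} \<and>
          pentagon (sqrt (3 - golden) * r) A B C D E" if "F facet_of P" for F
        using regular_pentagon[OF P(3)[rule_format, OF that]] by metis
    qed (use P in auto)
    obtain e1 e2 e3 K where e: "e1 \<bullet> e2 = 0" "e1 \<bullet> e3 = 0" "e2 \<bullet> e3 = 0"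
        "e1 \<bullet> e1 = K" "e2 \<bullet> e2 = K" "e3 \<bullet> e3 = K" "0 < K"
      and R: "R\<^sup>2 = 3 * K"
      and V: "(\<lambda>q. c + combine e1 e2 e3 q) ` set (dodecahedron_points golden) = vertices P"
      using coordinates card dod by metis
    have RK: "R\<^sup>2 / K = 3" using R e(7) by simp
    show ?thesis
      using dod dodecahedron_points_moments[OF golden_sq]
      by (intro identities_from_coordinates[OF assms(2) V distinct_dodecahedron_points[OF golden_sq] _ _ e on_sphere])
        (simp_all add: RK Let_def dodecahedron_points_def)
  qed
qed

end
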